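(* Let $n\ge 1$ and let $(G,H,P_G,B_H)$ be as in Case (A) or Case (B) described in the context. Then the map $\omega_{\tau_1,\tau_2}\mapsto B_H\,[\omega_{\tau_1,\tau_2}]$ induces a bijection $$\mathbb{Z}_2^n\backslash \Omega^{\circ}_n/(\mathbb{Z}_2^n\rtimes\mathfrak{S}_n)\;\xrightarrow{\ \sim\ }\; B_H\backslash G/P_G\;\simeq\; H\backslash \mathfrak{X}.$$ In particular, in both Cases (A) and (B) the orbit spaces $H\backslash\mathfrak{X}$ have the same set of representatives.
   Context: Case (A): $J_n=\sqrt{-1}\begin{pmatrix}0&\mathbf 1_n\\-\mathbf 1_n&0\end{pmatrix}$, $G=\mathrm{U}(n,n)=\{g\in\mathrm{GL}_{2n}(\mathbb C): g^*J_ng=J_n\}$ (where $g^*=\overline{g}^{\,t}$), $P_G=\left\{\begin{pmatrix}a&u\\0&(a^* )^{-1}\end{pmatrix}: a\in\mathrm{GL}_n(\mathbb C),\ a^{-1}u \text{ Hermitian}\right\}$ (the stabilizer of $\mathbb C^n\oplus 0$), $H=\{\mathrm{diag}(a,(a^* )^{-1}):a\in\mathrm{GL}_n(\mathbb C)\}\cong\mathrm{GL}_n(\mathbb C)$, $B_H=\{\mathrm{diag}(b,(b^* )^{-1}): b\in\mathrm{GL}_n(\mathbb C)\text{ upper triangular}\}$. Then $G/P_G$ is identified with the set of $n$-dimensional subspaces $W\subset\mathbb C^{2n}$ with $u^*J_nv=0$ for all $u,v\in W$ (Hermitian Lagrangian subspaces), a closed subset of $\mathrm{Gr}_n(\mathbb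 C^{2n})$. Case (B): $\Sigma_n=\begin{pmatrix}0&\mathbf 1_n\\-\mathbf 1_n&0\end{pmatrix}$, $G=\mathrm{Sp}_{2n}(\mathbb R)=\{g\in\mathrm{GL}_{2n}(\mathbb R): g^t\Sigma_ng=\Sigma_n\}$, $P_G=\left\{\begin{pmatrix}a&u\\0&(a^{t})^{-1}\end{pmatrix}: a\in\mathrm{GL}_n(\mathbb R),\ a^{-1}u\text{ symmetric}\right\}$, $H=\{\mathrm{diag}(a,(a^t)^{-1}):a\in\mathrm{GL}_n(\mathbb R)\}$, $B_H$ the same with $a$ real upper triangular invertible. $G/P_G$ is identified with the Lagrangian Grassmannian of $(\mathbb R^{2n},\Sigma_n)$ inside $\mathrm{Gr}_n(\mathbb R^{2n})$. In both cases $\mathfrak X=H/B_H\times G/P_G$ with diagonal $H$-action (the double flag variety), and $H\backslash\mathfrak X\simeq B_H\backslash G/P_G$ naturally. For a $2n\times n$ matrix $\omega$ of rank $n$, $[\omega]$ denotes its column space (image of $\omega$ as a linear map), an $n$-dimensional subspace. A signed partial permutation is an $n\times n$ integer matrix with entries in $\{-1,0,1\}$ having at most one nonzero entry in each row and each column; $\mathrm{SPP}_n$ is their set. $\Omega^{\circ}_n$ is the set of $\omega_{\tau_1,\tau_2}=\begin{pmatrix}\tau_1\\\tau_2\end{pmatrix}\in\mathrm M_{2n,n}(\mathbb Z)$ with $\tau_1,\tau_2\in\mathrm{SPP}_n$, $\tau_1^t\tau_2$ symmetric, and $\mathrm{rank}\,\omega_{\tau_1,\tau_2}=n$ (so $[\omega_{\tau_1,\tau_2}]$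 is a point of $G/P_G$ in both cases). The group $\mathbb Z_2^n=\{\pm1\}^n$ acts on $\Omega^\circ_n$ from the left by multiplication by $\mathrm{diag}(\varepsilon_1,\dots,\varepsilon_n,\varepsilon_1,\dots,\varepsilon_n)$, and $\mathbb Z_2^n\rtimes\mathfrak S_n$ (the group of $n\times n$ signed permutation matrices, generated by $\mathrm{diag}(\varepsilon_1,\dots,\varepsilon_n)$ and permutation matrices) acts by right multiplication. *)

theory Defs
  imports "HOL-Analysis.Analysis"
begin

text \<open>Index conventions.  The fixed size n is the cardinality of a finite linearly ordered
type 'n (so n \<ge> 1 automatically; the linear order is the order 1 < 2 < ... < n used for
"upper triangular").  Vectors of length 2n are indexed by the sum type 'n + 'n: Inl i is the
i-th coordinate of the first block, Inr i the i-th coordinate of the second block.\<close>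

definition blk_idx :: "'n + 'n \<Rightarrow> 'n" where
  "blk_idx k = (case k of Inl i \<Rightarrow> i | Inr i \<Rightarrow> i)"

definition Sigma_mat :: "'a::ring_1^('n::finite+'n)^('n+'n)" where
  "Sigma_mat = (\<chi> k l. case (k, l) of
       (Inl i, Inr j) \<Rightarrow> (if i = j then 1 else 0)
     | (Inr i, Inl j) \<Rightarrow> (if i = j then -1 else 0)
     | _ \<Rightarrow> 0)"

definition J_mat :: "complex^('n::finite+'n)^('n+'n)" where
  "J_mat = (\<chi> k l. \<i> * (Sigma_mat $ k $ l))"

text \<open>Conjugate transpose g^* with respect to a conjugation map cj (cnj for C, id for R).\<close>
definition conj_transpose :: "('a \<Rightarrow> 'a) \<Rightarrow> 'a^'m::finite^'n::finite \<Rightarrow> 'a^'n^'m" where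
  "conj_transpose cj g = (\<chi> i j. cj (g $ j $ i))"

definition sform :: "('a::field \<Rightarrow> 'a) \<Rightarrow> 'a^'k::finite^'k \<Rightarrow> 'a^'k \<Rightarrow> 'a^'k \<Rightarrow> 'a" where
  "sform cj M u v = (\<Sum>k\<in>UNIV. cj (u $ k) * ((M *v v) $ k))"

text \<open>G/P_G, identified with the set of n-dimensional subspaces W of the 2n-space with
u^* M v = 0 for all u, v in W (M = J_n, cj = complex conjugation in Case (A);
M = Sigma_n, cj = id in Case (B)).\<close>
definition LagGr :: "('a::field \<Rightarrow> 'a) \<Rightarrow> 'a^('n::finite+'n)^('n+'n) \<Rightarrow> ('a^('n+'n)) set set" where
  "LagGr cj M = {W. vec.subspace W \<and> vec.dim W = CARD('n) \<and>
                      (\<forall>u\<in>W. \<forall>v\<in>W. sform cj M u v = 0)}"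

definition upper_borel :: "((('a::field, 'n::{finite,linorder}) vec, 'n) vec) set" where
  "upper_borel = {b. invertible b \<and> (\<forall>i j. j < i \<longrightarrow> b $ i $ j = 0)}"

definition blockdiag :: "'a::zero^'n::finite^'n \<Rightarrow> 'a^'n^'n \<Rightarrow> 'a^('n+'n)^('n+'n)" where
  "blockdiag a c = (\<chi> k l. case (k, l) of
       (Inl i, Inl j) \<Rightarrow> a $ i $ j
     | (Inr i, Inr j) \<Rightarrow> c $ i $ j
     | _ \<Rightarrow> 0)"

definition H_elt :: "('a::field \<Rightarrow> 'a) \<Rightarrow> 'a^'n::finite^'n \<Rightarrow> 'a^('n+'n)^('n+'n)" where
  "H_elt cj b = blockdiag b (matrix_inv (conj_transpose cj b))"

definition BH_rel where
  "BH_rel cj M = {(W, W'). W \<in> LagGr cj M \<and> W' \<in> LagGr cj M \<and>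
                      (\<exists>b\<in>upper_borel. W' = (\<lambda>v. H_elt cj b *v v) ` W)}"

definition SPP :: "(int^'n::finite^'n) set" where
  "SPP = {t. (\<forall>i j. t $ i $ j \<in> {-1, 0, 1}) \<and>
             (\<forall>i j j'. t $ i $ j \<noteq> 0 \<and> t $ i $ j' \<noteq> 0 \<longrightarrow> j = j') \<and>
             (\<forall>i i' j. t $ i $ j \<noteq> 0 \<and> t $ i' $ j \<noteq> 0 \<longrightarrow> i = i')}"

text \<open>Signed permutation matrices (the group Z_2^n \<rtimes> S_n).\<close>
definition signed_perms :: "(int^'n::finite^'n) set" where
  "signed_perms = {s. s \<in> SPP \<and> (\<forall>i. \<exists>j. s $ i $ j \<noteq> 0) \<and> (\<forall>j. \<exists>i. s $ i $ j \<noteq> 0)}"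

definition top_blk :: "'a^'n::finite^('n+'n) \<Rightarrow> 'a^'n^'n" where
  "top_blk w = (\<chi> i j. w $ Inl i $ j)"
definition bot_blk :: "'a^'n::finite^('n+'n) \<Rightarrow> 'a^'n^'n" where
  "bot_blk w = (\<chi> i j. w $ Inr i $ j)"

definition Omega_circ :: "(int^'n::finite^('n+'n)) set" where
  "Omega_circ = {w. top_blk w \<in> SPP \<and> bot_blk w \<in> SPP \<and>
                    transpose (transpose (top_blk w) ** bot_blk w) = transpose (top_blk w) ** bot_blk w \<and>
                    rank (map_matrix (of_int :: int \<Rightarrow> real) w) = CARD('n)}"

definition sign_act :: "('n::finite \<Rightarrow> int) \<Rightarrow> int^'n^('n+'n) \<Rightarrow> int^'n^('n+'n)" where
  "sign_act e w = (\<chi> k j. e (blk_idx k) * w $ k $ j)"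

definition Omega_rel :: "((int^'n::finite^('n+'n)) \<times> (int^'n^('n+'n))) set" where
  "Omega_rel = {(w, w'). w \<in> Omega_circ \<and> w' \<in> Omega_circ \<and>
     (\<exists>e s. (\<forall>i. e i \<in> {-1, 1}) \<and> s \<in> signed_perms \<and> w' = sign_act e w ** s)}"

definition colspace :: "int^'n::finite^('n+'n) \<Rightarrow> ('a::field^('n+'n)) set" where
  "colspace w = range (\<lambda>c. map_matrix of_int w *v c)"

definition induced_map where
  "induced_map cj M X = (\<Union>w\<in>X. BH_rel cj M `` {colspace w})"

definition orbit_bijection where
  "orbit_bijection cj M \<longleftrightarrow>
     bij_betw (induced_map cj M) (Omega_circ // Omega_rel) (LagGr cj M // BH_rel cj M)"

end

theory Submission
  imports Defs
begin

text \<open>A Lagrangian subspace \<open>W\<close> consists of pairs \<open>(x, y)\<close>, and \<open>b\<close> acts by \<open>(x, y) \<mapsto> (b x, (b\<^sup>*)\<inverse> y)\<close>: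
upper triangular on the first block, lower triangular on the second.

Injectivity. A column of a representative has at most one entry in each block, so its image under
\<open>b\<close> has a last nonzero entry in the first block and a first nonzero entry in the second, at the
original positions. Expanding the image in the columns of the other representative compares the
positions of the entries; using \<open>b\<inverse>\<close> as well shows that they agree. A column
\<open>e\<^sub>p \<plusminus> e'\<^sub>p\<close> keeps its sign because \<open>b\<^sub>p\<^sub>p \<cdot> cj b\<^sub>p\<^sub>p\<close> is never \<open>-1\<close>; the columns with positions
\<open>(p, q)\<close>, \<open>p \<noteq> q\<close>, come in pairs \<open>(p, q)\<close>, \<open>(q, p)\<close> whose common sign can be absorbed.

Surjectivity. Split off coordinates one or two at a time. Let \<open>m\<close> be the least remaining index.
If \<open>e\<^sub>m \<in> W\<close>, split it off. Otherwise some \<open>(x, y) \<in> W\<close> has \<open>y\<^sub>m = 1\<close>; choose it with \<open>x\<close> of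
smallest possible last nonzero position \<open>p\<close>. If \<open>x = 0\<close> or \<open>p = m\<close>, a single row operation
produces \<open>e'\<^sub>m\<close> or \<open>e\<^sub>m \<plusminus> e'\<^sub>m\<close>. If \<open>p > m\<close>, minimality and \<open>W\<^sup>\<bottom> = W\<close> give \<open>(e\<^sub>m, z) \<in> W\<close> with
\<open>z\<close> starting at position \<open>p\<close>, and one \<open>b\<close> with rows \<open>y\<^sup>*\<close> and \<open>z\<^sup>*\<close> turns both vectors into
\<open>e\<^sub>p + e'\<^sub>m\<close> and \<open>e\<^sub>m + e'\<^sub>p\<close>.\<close>

subsection \<open>Vectors in two blocks\<close>

lemma sum_UNIV_Plus:
  fixes f :: "'n::finite + 'n \<Rightarrow> 'a::comm_monoid_add"
  shows "(\<Sum>k\<in>UNIV. f k) = (\<Sum>i\<in>UNIV. f (Inl i)) + (\<Sum>i\<in>UNIV. f (Inr i))"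
  by (subst UNIV_Plus_UNIV[symmetric], subst sum.Plus) auto

definition join_vec :: "'a^'n \<Rightarrow> 'a^'n \<Rightarrow> 'a^('n::finite+'n)" where
  "join_vec x y = (\<chi> k. case k of Inl i \<Rightarrow> x $ i | Inr i \<Rightarrow> y $ i)"

lemma join_vec_nth [simp]:
  "join_vec x y $ Inl i = x $ i" "join_vec x y $ Inr i = y $ i"
  by (simp_all add: join_vec_def)

lemma join_vec_eq_iff [simp]: "join_vec x y = join_vec x' y' \<longleftrightarrow> x = x' \<and> y = y'"
  by (metis join_vec_nth vec_eq_iff)

lemma join_vec_surj: "v = join_vec (\<chi> i. v $ Inl i) (\<chi> i. v $ Inr i)"
  by (auto simp: vec_eq_iff join_vec_def split: sum.split)

lemma join_vec_cases: obtains x y where "v = join_vec x y"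
  using join_vec_surj by blast

lemma join_vec_add: "join_vec x y + join_vec x' y' = join_vec (x + x') (y + y')"
  by (auto simp: vec_eq_iff join_vec_def split: sum.split)

lemma join_vec_diff: "join_vec x y - join_vec x' y' = join_vec (x - x') (y - y')"
  for x :: "'a::group_add^'n::finite"
  by (auto simp: vec_eq_iff join_vec_def split: sum.split)

lemma join_vec_scale: "c *s join_vec x y = join_vec (c *s x) (c *s y)"
  by (auto simp: vec_eq_iff join_vec_def split: sum.split)

text \<open>The form \<open>x^* y\<close>. It is used to pair the first block with the second, on
  which \<open>b\<close> acts by the inverse adjoint, so that it is invariant under the
  group.\<close>

definition pairing :: "('a::field \<Rightarrow> 'a) \<Rightarrow> 'a^'n::finite \<Rightarrow> 'a^'n \<Rightarrow> 'a" where
  "pairing cj x y = (\<Sum>i\<in>UNIV. cj (x $ i) * y $ i)"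

lemma pairing_diff_right: "pairing cj x (y - z) = pairing cj x y - pairing cj x z"
  by (simp add: pairing_def algebra_simps sum_subtractf)

lemma pairing_scale_right: "pairing cj x (c *s y) = c * pairing cj x y"
  by (simp add: pairing_def sum_distrib_left algebra_simps)

lemma pairing_0_right [simp]: "pairing cj x 0 = 0"
  by (simp add: pairing_def)

lemma pairing_axis_right: "pairing cj x (axis i c) = cj (x $ i) * c"
  by (simp add: pairing_def axis_def if_distrib cong: if_cong)

lemma sform_Sigma:
  "sform cj Sigma_mat (join_vec x y) (join_vec x' y') = pairing cj x y' - pairing cj y x'"
  by (simp add: sform_def pairing_def sum_UNIV_Plus matrix_vector_mult_def Sigma_mat_def
      if_distrib[of "\<lambda>c. c * _"] sum_negf cong: if_cong)

lemma sform_J: "sform cj J_mat u v = \<i> * sform cj Sigma_mat u v"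
proof -
  have "(J_mat *v v) $ k = \<i> * (Sigma_mat *v v) $ k" for k
    by (simp add: matrix_vector_mult_def J_mat_def sum_distrib_left mult.assoc)
  then show ?thesis
    by (simp add: sform_def sum_distrib_left mult.left_commute)
qed

text \<open>The nonzero factor \<open>\<i>\<close> does not affect isotropy. This reduces Case (A)
  to \<open>Sigma_mat\<close>, so that one argument serves both cases.\<close>

lemma LagGr_J: "LagGr cj J_mat = LagGr cj Sigma_mat"
  by (simp add: LagGr_def sform_J)

lemma orbit_bijection_J:
  "orbit_bijection cj (J_mat :: ((complex, 'n::{finite,linorder} + 'n) vec, 'n + 'n) vec)
    \<longleftrightarrow> orbit_bijection cj (Sigma_mat :: ((complex, 'n + 'n) vec, 'n + 'n) vec)"
proof -
  have "BH_rel cj (J_mat :: ((complex, 'n + 'n) vec, 'n + 'n) vec) = BH_rel cj Sigma_mat"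
    by (simp add: BH_rel_def LagGr_J)
  then show ?thesis
    by (simp add: orbit_bijection_def LagGr_J induced_map_def[abs_def])
qed

subsection \<open>Upper triangular matrices\<close>

lemma upper_mult_vec_zero:
  fixes b :: "(('a::field, 'n::{finite,linorder}) vec, 'n) vec"
  assumes "\<And>i j. j < i \<Longrightarrow> b $ i $ j = 0" "\<And>k. i < k \<Longrightarrow> x $ k = 0" "i < k"
  shows "(b *v x) $ k = 0"
  unfolding matrix_vector_mult_def using assms
  by (auto intro!: sum.neutral) (metis less_trans linorder_cases)

text \<open>In row \<open>i\<close>, triangularity kills the terms before \<open>i\<close> and the
  support of \<open>x\<close> those after \<open>i\<close>. This control of the last nonzero entry
  carries most arguments about triangular matrices.\<close>

lemma upper_mult_vec_lead:
  fixes b :: "(('a::field, 'n::{finite,linorder}) vec, 'n) vec"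
  assumes "\<And>i j. j < i \<Longrightarrow> b $ i $ j = 0" "\<And>k. i < k \<Longrightarrow> x $ k = 0"
  shows "(b *v x) $ i = b $ i $ i * x $ i"
proof -
  have "(\<Sum>j\<in>UNIV. b $ i $ j * x $ j) = (\<Sum>j\<in>UNIV. if j = i then b $ i $ i * x $ i else 0)"
    using assms by (intro sum.cong refl) (metis linorder_cases mult_zero_left mult_zero_right)
  then show ?thesis
    by (simp add: matrix_vector_mult_def)
qed

lemma obtain_last_nonzero:
  fixes x :: "'a::zero^'n::{finite,linorder}"
  assumes "x \<noteq> 0"
  obtains i where "x $ i \<noteq> 0" "\<And>k. i < k \<Longrightarrow> x $ k = 0"
proof -
  let ?S = "{i. x $ i \<noteq> 0}"
  have "?S \<noteq> {}" using assms by (auto simp: vec_eq_iff)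
  then have "Max ?S \<in> ?S" by (intro Max_in) auto
  moreover have "x $ k = 0" if "Max ?S < k" for k
    by (metis (mono_tags, lifting) Max_ge finite_code leD mem_Collect_eq that)
  ultimately show ?thesis using that[of "Max ?S"] by blast
qed

text \<open>A nonzero kernel vector would have a last nonzero entry, and \<open>b\<close> only
  multiplies that entry by a nonzero diagonal entry.\<close>

lemma upper_borelI:
  fixes b :: "(('a::field, 'n::{finite,linorder}) vec, 'n) vec"
  assumes "\<And>i j. j < i \<Longrightarrow> b $ i $ j = 0" "\<And>i. b $ i $ i \<noteq> 0"
  shows "b \<in> upper_borel"
proof -
  have "x = 0" if "b *v x = 0" for x
  proof (rule ccontr)
    assume "x \<noteq> 0"
    then obtain i where "x $ i \<noteq> 0" "\<And>k. i < k \<Longrightarrow> x $ k = 0"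
      using obtain_last_nonzero by blast
    then have "(b *v x) $ i \<noteq> 0"
      using assms upper_mult_vec_lead[of b i x] by auto
    then show False using that by simp
  qed
  then have "invertible b"
    using matrix_left_invertible_ker[of b] invertible_left_inverse[of b] by blast
  then show ?thesis using assms by (simp add: upper_borel_def)
qed

text \<open>With a zero at \<open>(i, i)\<close>, the matrix would map the vectors supported on
  \<open>{..i}\<close> injectively into those supported on \<open>{..<i}\<close>, a space of smaller
  dimension.\<close>

lemma upper_borel_diag_nz:
  fixes b :: "(('a::field, 'n::{finite,linorder}) vec, 'n) vec"
  assumes "b \<in> upper_borel"
  shows "b $ i $ i \<noteq> 0"
proof
  assume 0: "b $ i $ i = 0"
  have up: "\<And>i j. j < i \<Longrightarrow> b $ i $ j = 0" and inv: "invertible b"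
    using assms by (auto simp: upper_borel_def)
  let ?V = "{x::('a,'n) vec. \<forall>k. k \<notin> {..i} \<longrightarrow> x $ k = 0}"
  let ?V' = "{x::('a,'n) vec. \<forall>k. k \<notin> {..<i} \<longrightarrow> x $ k = 0}"
  have "(*v) b ` ?V \<subseteq> ?V'"
  proof clarsimp
    fix x :: "('a,'n) vec" and k assume x: "\<forall>k. \<not> k \<le> i \<longrightarrow> x $ k = 0" and "\<not> k < i"
    then have "i = k \<or> i < k" by auto
    then show "(b *v x) $ k = 0"
      using upper_mult_vec_zero[OF up, of i x k] upper_mult_vec_lead[OF up, of i x] x 0 by auto
  qed
  then have "vec.dim ((*v) b ` ?V) \<le> vec.dim ?V'"
    by (rule vec.dim_subset)
  moreover have "vec.dim ((*v) b ` ?V) = vec.dim ?V"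
    by (rule vec.dim_image_eq) (auto intro: inj_on_subset[OF inj_matrix_vector_mult[OF inv]])
  ultimately have "card {..i} \<le> card {..<i}"
    using dim_substandard_cart[of "{..i}", where 'a='a] dim_substandard_cart[of "{..<i}", where 'a='a]
    by simp
  moreover have "card {..<i} < card {..i}"
    by (intro psubset_card_mono) auto
  ultimately show False by simp
qed

lemma upper_borel_mult:
  fixes b c :: "(('a::field, 'n::{finite,linorder}) vec, 'n) vec"
  assumes "b \<in> upper_borel" "c \<in> upper_borel"
  shows "b ** c \<in> upper_borel"
proof -
  have "(b ** c) $ i $ j = 0" if "j < i" for i j
    unfolding matrix_matrix_mult_def using assms that
    by (auto simp: upper_borel_def intro!: sum.neutral) (metis less_trans linorder_cases)
  then show ?thesis
    using assms by (auto simp: upper_borel_def intro: invertible_mult)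
qed

lemma upper_borel_inverse:
  fixes b :: "(('a::field, 'n::{finite,linorder}) vec, 'n) vec"
  assumes "b \<in> upper_borel"
  obtains c where "c \<in> upper_borel" "b ** c = mat 1" "c ** b = mat 1"
proof -
  obtain c where c: "b ** c = mat 1" "c ** b = mat 1"
    using assms by (auto simp: upper_borel_def invertible_def)
  have up: "\<And>i j. j < i \<Longrightarrow> b $ i $ j = 0" using assms by (auto simp: upper_borel_def)
  have "c $ i $ j = 0" if "j < i" for i j
  proof (rule ccontr)
    assume nz: "c $ i $ j \<noteq> 0"
    \<comment> \<open>The part of column \<open>j\<close> of \<open>c\<close> strictly below the
      diagonal. If it is nonzero, its last nonzero entry is also the last one of the whole column
      and survives in \<open>b ** c\<close>, off the diagonal.\<close>
    define x where "x = (\<chi> k. if k \<le> j then 0 else c $ k $ j)"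
    have "x \<noteq> 0" using nz that by (auto simp: x_def vec_eq_iff intro!: exI[of _ i])
    then obtain k where k: "x $ k \<noteq> 0" "\<And>l. k < l \<Longrightarrow> x $ l = 0" by (rule obtain_last_nonzero) blast
    then have "j < k" by (auto simp: x_def split: if_splits)
    have "(b ** c) $ k $ j = (b *v (\<chi> l. c $ l $ j)) $ k"
      by (simp add: matrix_matrix_mult_def matrix_vector_mult_def)
    also have "\<dots> = b $ k $ k * c $ k $ j"
    proof (subst upper_mult_vec_lead[OF up])
      show "(\<chi> l. c $ l $ j) $ l = 0" if "k < l" for l
        using k(2)[OF that] \<open>j < k\<close> that by (auto simp: x_def split: if_splits)
    qed auto
    finally have "(b ** c) $ k $ j \<noteq> 0"
      using k(1) upper_borel_diag_nz[OF assms, of k] by (auto simp: x_def split: if_splits)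
    then show False using \<open>j < k\<close> by (auto simp: c mat_def split: if_splits)
  qed
  then have "c \<in> upper_borel" using c by (auto simp: upper_borel_def invertible_def)
  then show ?thesis using c that by blast
qed

subsection \<open>Lagrangian subspaces over a field with involution\<close>

text \<open>Common frame for the complex numbers with conjugation and the reals with the identity.
  \<open>norm_neq_m1\<close> keeps the two signs apart (injectivity);
  \<open>selfadjoint_scale\<close> turns selfadjoint coefficients into signs (surjectivity).\<close>

locale involutive_field =
  fixes cj :: "'a::field_char_0 \<Rightarrow> 'a"
  assumes cj_add: "cj (x + y) = cj x + cj y"
    and cj_mult: "cj (x * y) = cj x * cj y"
    and cj_cj [simp]: "cj (cj x) = x"
    and norm_neq_m1: "u * cj u \<noteq> -1"
    and selfadjoint_scale: "cj x = x \<Longrightarrow> x \<noteq> 0 \<Longrightarrow> \<exists>u. u \<noteq> 0 \<and> (x * (u * cj u) = 1 \<or> x * (u * cj u) = -1)"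
begin

section \<open>Arithmetic of the involution and of the pairing\<close>

lemma cj_0 [simp]: "cj 0 = 0"
  using cj_add[of 0 0] by simp

lemma cj_eq_0 [simp]: "cj x = 0 \<longleftrightarrow> x = 0"
  by (metis cj_0 cj_cj)

lemma cj_1 [simp]: "cj 1 = 1"
  using cj_mult[of 1 1] cj_eq_0[of 1] by simp

lemma cj_minus [simp]: "cj (- x) = - cj x"
  by (metis add.right_inverse cj_0 cj_add eq_neg_iff_add_eq_0 add.commute)

lemma cj_diff: "cj (x - y) = cj x - cj y"
  by (metis cj_add cj_minus uminus_add_conv_diff add.commute)

lemma cj_sum: "cj (\<Sum>i\<in>I. f i) = (\<Sum>i\<in>I. cj (f i))"
  by (induction I rule: infinite_finite_induct) (auto simp: cj_add)

lemma cj_divide: "cj (x / y) = cj x / cj y"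
  by (cases "y = 0") (auto simp: cj_mult[symmetric] field_simps)

lemma cj_of_nat [simp]: "cj (of_nat n) = of_nat n"
  by (induction n) (auto simp: cj_add)

lemma cj_of_int [simp]: "cj (of_int n) = of_int n"
  by (cases n) (auto simp: cj_diff)

lemma cj_half: "cj (x / 2) = cj x / 2"
  using cj_of_nat[of 2] by (simp add: cj_divide)

lemma cj_pairing: "cj (pairing cj x y) = pairing cj y x"
  by (simp add: pairing_def cj_sum cj_mult mult.commute)

lemma pairing_diff_left: "pairing cj (x - z) y = pairing cj x y - pairing cj z y"
  by (simp add: pairing_def cj_diff algebra_simps sum_subtractf)

lemma pairing_scale_left: "pairing cj (c *s x) y = cj c * pairing cj x y"
  by (simp add: pairing_def sum_distrib_left cj_mult algebra_simps)

lemma pairing_axis_left: "pairing cj (axis i c) x = cj c * x $ i"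
  by (simp add: pairing_def axis_def if_distrib[of "\<lambda>c. c * _"] if_distrib[of cj] cong: if_cong)

lemma pairing_adjoint: "pairing cj (conj_transpose cj b *v x) y = pairing cj x (b *v y)"
proof -
  have "pairing cj (conj_transpose cj b *v x) y
      = (\<Sum>i\<in>UNIV. \<Sum>j\<in>UNIV. b $ j $ i * cj (x $ j) * y $ i)"
    by (simp add: pairing_def matrix_vector_mult_def conj_transpose_def cj_sum cj_mult sum_distrib_right)
  also have "\<dots> = (\<Sum>j\<in>UNIV. \<Sum>i\<in>UNIV. b $ j $ i * cj (x $ j) * y $ i)"
    by (rule sum.swap)
  also have "\<dots> = pairing cj x (b *v y)"
    by (simp add: pairing_def matrix_vector_mult_def sum_distrib_left mult_ac)
  finally show ?thesis .
qed

section \<open>The group action on the two blocks\<close>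

lemma conj_transpose_mult:
  "conj_transpose cj (b ** c) = conj_transpose cj c ** conj_transpose cj b"
  by (simp add: conj_transpose_def matrix_matrix_mult_def vec_eq_iff cj_sum cj_mult mult.commute)

lemma conj_transpose_1 [simp]: "conj_transpose cj (mat 1) = mat 1"
  by (auto simp: conj_transpose_def mat_def vec_eq_iff)

text \<open>\<open>matrix_inv\<close> is defined by a choice; uniqueness of inverses replaces it by
  the adjoint of any explicit inverse \<open>c\<close> of \<open>b\<close>.\<close>

lemma H_elt_inverse:
  assumes "b ** c = mat 1"
  shows "H_elt cj b *v join_vec x y = join_vec (b *v x) (conj_transpose cj c *v y)"
proof -
  have 1: "conj_transpose cj c ** conj_transpose cj b = mat 1"
    by (metis assms conj_transpose_mult conj_transpose_1)
  then have 2: "conj_transpose cj b ** conj_transpose cj c = mat 1"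
    using matrix_left_right_inverse by blast
  have "matrix_inv (conj_transpose cj b) = conj_transpose cj c"
    unfolding matrix_inv_def
  proof (rule some_equality)
    fix A assume "conj_transpose cj b ** A = mat 1 \<and> A ** conj_transpose cj b = mat 1"
    then show "A = conj_transpose cj c"
      by (metis 1 matrix_mul_assoc matrix_mul_lid matrix_mul_rid)
  qed (use 1 2 in auto)
  then show ?thesis
    by (auto simp: H_elt_def blockdiag_def join_vec_def vec_eq_iff matrix_vector_mult_def sum_UNIV_Plus
        split: sum.split)
qed

lemma H_elt_1: "H_elt cj (mat 1) *v v = v"
  by (cases v rule: join_vec_cases) (simp add: H_elt_inverse)

text \<open>Describes the image without inverting \<open>b\<close>: it suffices to guess the second
  block \<open>y'\<close> and apply the adjoint to it. The reduction steps use this for matrices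
  \<open>b\<close> given by their rows.\<close>

lemma H_elt_adjoint:
  assumes "b \<in> upper_borel" "conj_transpose cj b *v y' = y"
  shows "H_elt cj b *v join_vec x y = join_vec (b *v x) y'"
proof -
  obtain c where c: "b ** c = mat 1" "c ** b = mat 1"
    using upper_borel_inverse[OF assms(1)] by metis
  have "conj_transpose cj c *v y = (conj_transpose cj (b ** c)) *v y'"
    by (simp add: assms(2)[symmetric] conj_transpose_mult matrix_vector_mul_assoc)
  then show ?thesis
    by (simp add: H_elt_inverse[OF c(1)] c)
qed

section \<open>Isotropy and maximality of Lagrangian subspaces\<close>

abbreviation Lag :: "('a^('n::finite+'n)) set set" where
  "Lag \<equiv> LagGr cj Sigma_mat"

lemma Lag_isotropic:
  assumes "W \<in> Lag" "join_vec x y \<in> W" "join_vec x' y' \<in> W"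
  shows "pairing cj x y' = pairing cj y x'"
proof -
  have "sform cj Sigma_mat (join_vec x y) (join_vec x' y') = 0"
    using assms unfolding LagGr_def by blast
  then show ?thesis by (simp add: sform_Sigma)
qed

lemma Lag_subspace: "W \<in> Lag \<Longrightarrow> vec.subspace W"
  by (simp add: LagGr_def)

lemma Lag_diff:
  assumes "W \<in> Lag" "join_vec x y \<in> W" "join_vec x' y' \<in> W"
  shows "join_vec (x - x') (y - y') \<in> W"
  using vec.subspace_diff[OF Lag_subspace[OF assms(1)] assms(2,3)] by (simp add: join_vec_diff)

lemma Lag_scale:
  assumes "W \<in> Lag" "join_vec x y \<in> W"
  shows "join_vec (c *s x) (c *s y) \<in> W"
  using vec.subspace_scale[OF Lag_subspace[OF assms(1)] assms(2)] by (simp add: join_vec_scale)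

text \<open>The orthogonal of \<open>W\<close> contains \<open>W\<close> and has the same dimension,
  so the two coincide. This is how membership in \<open>W\<close> is proved later: by testing
  orthogonality alone.\<close>

lemma Lag_maximal:
  fixes W :: "('a^('n::finite+'n)) set"
  assumes W: "W \<in> Lag"
    and perp: "\<And>x' y'. join_vec x' y' \<in> W \<Longrightarrow> pairing cj x' y = pairing cj y' x"
  shows "join_vec x y \<in> W"
proof -
  have sub: "vec.subspace W" and dimW: "vec.dim W = CARD('n)"
    using W by (auto simp: LagGr_def)
  have "vec.dim W = vec.dim (UNIV::('a^'n) set)"
    using dimW vec_dim_card[where 'n='n and 'a='a] by metis
  then obtain f where f: "Vector_Spaces.linear (*s) (*s) f" "f ` (UNIV::('a^'n) set) = W" "inj f"
    using vec.subspace_isomorphism[OF vec.subspace_UNIV sub] by metis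
  define A where "A = matrix f"
  have A: "A *v c = f c" for c by (simp add: A_def matrix_works f)
  \<comment> \<open>the kernel of \<open>M = A\<^sup>* \<Sigma>\<close> is the orthogonal of \<open>W\<close>; it has dimension \<open>n\<close> as \<open>M\<close> is surjective\<close>
  define M :: "'a^('n+'n)^'n" where
    "M = (\<chi> j k. case k of Inl i \<Rightarrow> - cj (A $ Inr i $ j) | Inr i \<Rightarrow> cj (A $ Inl i $ j))"
  have M: "(M *v join_vec x y) $ j
      = pairing cj (\<chi> i. A $ Inl i $ j) y - pairing cj (\<chi> i. A $ Inr i $ j) x" for x y j
    by (simp add: M_def matrix_vector_mult_def sum_UNIV_Plus pairing_def sum_negf)
  have col: "join_vec (\<chi> i. A $ Inl i $ j) (\<chi> i. A $ Inr i $ j) \<in> W" for j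
  proof -
    have "join_vec (\<chi> i. A $ Inl i $ j) (\<chi> i. A $ Inr i $ j) = A *v axis j 1"
      by (auto simp: vec_eq_iff join_vec_def matrix_vector_mult_def axis_def if_distrib cong: if_cong split: sum.split)
    then show ?thesis using A f(2) by auto
  qed
  let ?K = "{v. M *v v = 0}"
  have "W \<subseteq> ?K"
  proof
    fix v assume v: "v \<in> W"
    obtain x y where "v = join_vec x y" by (rule join_vec_cases)
    then show "v \<in> ?K" using Lag_isotropic[OF W col] v by (simp add: vec_eq_iff[where y=0] M)
  qed
  have "vec.dim ?K \<le> CARD('n)"
  proof -
    obtain L where L: "L ** A = mat 1"
      using matrix_left_invertible_injective[of A] f(3) A by (metis ext)
    \<comment> \<open>The left inverse \<open>L\<close> of \<open>A\<close>, conjugated and with its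
      blocks exchanged, is a right inverse of \<open>M\<close>. Its range has dimension n and meets
      the kernel of \<open>M\<close> only in 0, which bounds the dimension of the kernel.\<close>
    define R :: "'a^'n^('n+'n)" where
      "R = (\<chi> k j. case k of Inl i \<Rightarrow> - cj (L $ j $ Inr i) | Inr i \<Rightarrow> cj (L $ j $ Inl i))"
    have MR: "M ** R = mat 1"
    proof -
      have "(M ** R) $ j $ l = cj ((L ** A) $ l $ j)" for j l
        by (simp add: M_def R_def matrix_matrix_mult_def sum_UNIV_Plus cj_add cj_sum cj_mult mult.commute
            add.commute)
      then show ?thesis by (auto simp: L vec_eq_iff mat_def)
    qed
    have inj: "inj ((*v) R)" using MR matrix_left_invertible_injective by blast
    have subs: "vec.subspace ?K" "vec.subspace (range ((*v) R))"
      by (auto intro: vec.linear_subspace_kernel vec.linear_subspace_image)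
    have int: "?K \<inter> range ((*v) R) = {0}"
      by (auto simp: matrix_vector_mul_assoc MR intro!: range_eqI[of _ _ 0])
    have "vec.dim (range ((*v) R)) = CARD('n)"
      using vec.dim_image_eq[of "(*v) R" UNIV] inj vec_dim_card[where 'n='n and 'a='a]
      by (simp del: vec.dim_UNIV)
    then have "vec.dim {u + v |u v. u \<in> ?K \<and> v \<in> range ((*v) R)} = vec.dim ?K + CARD('n)"
      using vec.dim_sums_Int[OF subs] int by simp
    moreover have "vec.dim {u + v |u v. u \<in> ?K \<and> v \<in> range ((*v) R)} \<le> CARD('n + 'n)"
      by (rule dim_subset_UNIV_cart_gen)
    ultimately show ?thesis by simp
  qed
  then have "W = ?K"
    using vec.subspace_dim_equal[OF sub _ \<open>W \<subseteq> ?K\<close>] dimW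
    by (auto intro: vec.linear_subspace_kernel)
  moreover have "join_vec x y \<in> ?K"
    using perp[OF col] by (simp add: M vec_eq_iff)
  ultimately show ?thesis by blast
qed

section \<open>Borel orbits of Lagrangian subspaces\<close>

lemma BH_image_Lag:
  fixes W :: "('a^('n::{finite,linorder}+'n)) set"
  assumes W: "W \<in> Lag" and b: "b \<in> upper_borel"
  shows "(\<lambda>v. H_elt cj b *v v) ` W \<in> Lag"
proof -
  obtain c where c: "b ** c = mat 1" "c ** b = mat 1"
    using upper_borel_inverse[OF b] by metis
  note H = H_elt_inverse[OF c(1)]
  have inj: "inj ((*v) (H_elt cj b))"
  proof (rule injI)
    fix u v assume eq: "H_elt cj b *v u = H_elt cj b *v v"
    obtain x y x' y' where uv: "u = join_vec x y" "v = join_vec x' y'" by (metis join_vec_cases)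
    have "c *v (b *v x) = c *v (b *v x')"
      "conj_transpose cj b *v (conj_transpose cj c *v y) = conj_transpose cj b *v (conj_transpose cj c *v y')"
      using eq by (auto simp: uv H)
    then show "u = v"
      by (simp add: uv matrix_vector_mul_assoc c conj_transpose_mult[symmetric])
  qed
  have "sform cj Sigma_mat (H_elt cj b *v u) (H_elt cj b *v v) = sform cj Sigma_mat u v" for u v
  proof -
    obtain x y x' y' where uv: "u = join_vec x y" "v = join_vec x' y'" by (metis join_vec_cases)
    \<comment> \<open>Moving the adjoint of \<open>c\<close> to the other side produces
      \<open>c ** b\<close>, so the action preserves the pairing of the blocks and hence the
      form.\<close>
    have "pairing cj (conj_transpose cj c *v y) (b *v x') = pairing cj y x'" for y x'
      by (simp add: pairing_adjoint matrix_vector_mul_assoc c)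
    moreover have "pairing cj (b *v x) (conj_transpose cj c *v y') = pairing cj x y'" for x y'
      using calculation[of y' x] by (metis cj_pairing)
    ultimately show ?thesis by (simp add: uv H sform_Sigma)
  qed
  moreover have "vec.dim ((*v) (H_elt cj b) ` W) = vec.dim W"
    by (rule vec.dim_image_eq) (auto intro: inj_on_subset[OF inj])
  ultimately show ?thesis
    using W by (auto simp: LagGr_def intro!: vec.linear_subspace_image)
qed

lemma H_elt_image_inverse:
  fixes W :: "('a^('n::{finite,linorder}+'n)) set"
  assumes "b ** c = mat 1" "c ** b = mat 1"
  shows "(\<lambda>v. H_elt cj c *v v) ` (\<lambda>v. H_elt cj b *v v) ` W = W"
proof -
  have "H_elt cj c *v (H_elt cj b *v v) = v" for v
    by (cases v rule: join_vec_cases, simp add: H_elt_inverse[OF assms(1)] H_elt_inverse[OF assms(2)] del: matrix_vector_mul_assoc)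
      (simp add: matrix_vector_mul_assoc conj_transpose_mult[symmetric] assms)
  then show ?thesis by (simp add: image_image)
qed

lemma H_elt_mult:
  assumes "b \<in> upper_borel" "b' \<in> upper_borel"
  shows "H_elt cj b *v (H_elt cj b' *v v) = H_elt cj (b ** b') *v v"
proof -
  obtain c where c: "b ** c = mat 1" "c ** b = mat 1"
    using upper_borel_inverse[OF assms(1)] by metis
  obtain c' where c': "b' ** c' = mat 1" "c' ** b' = mat 1"
    using upper_borel_inverse[OF assms(2)] by metis
  have "(b ** b') ** (c' ** c) = mat 1"
    by (metis c c' matrix_mul_assoc matrix_mul_rid)
  then show ?thesis
    by (cases v rule: join_vec_cases, simp add: H_elt_inverse[OF c(1)] H_elt_inverse[OF c'(1)] H_elt_inverse)
      (simp add: matrix_vector_mul_assoc conj_transpose_mult)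
qed

lemma mat_1_upper_borel: "mat 1 \<in> upper_borel"
  by (rule upper_borelI) (auto simp: mat_def)

lemma equiv_BH_rel:
  "equiv (Lag :: ('a^('n::{finite,linorder}+'n)) set set) (BH_rel cj Sigma_mat)"
proof (rule equivI)
  show "BH_rel cj Sigma_mat \<subseteq> (Lag :: ('a^('n::{finite,linorder}+'n)) set set) \<times> Lag"
    by (auto simp: BH_rel_def)
  show "refl_on (Lag :: ('a^('n::{finite,linorder}+'n)) set set) (BH_rel cj Sigma_mat)"
  proof (rule refl_onI)
    fix W :: "('a^('n+'n)) set" assume "W \<in> Lag"
    then show "(W, W) \<in> BH_rel cj Sigma_mat"
      by (auto simp: BH_rel_def H_elt_1 intro!: bexI[OF _ mat_1_upper_borel])
  qed
  show "sym (BH_rel cj (Sigma_mat :: 'a^('n+'n)^('n+'n)))"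
  proof (rule symI)
    fix W W' :: "('a^('n+'n)) set" assume "(W, W') \<in> BH_rel cj Sigma_mat"
    then obtain b where b: "b \<in> upper_borel" "W' = (\<lambda>v. H_elt cj b *v v) ` W" "W \<in> Lag" "W' \<in> Lag"
      by (auto simp: BH_rel_def)
    obtain c where "c \<in> upper_borel" "b ** c = mat 1" "c ** b = mat 1"
      using upper_borel_inverse[OF b(1)] by metis
    then show "(W', W) \<in> BH_rel cj Sigma_mat"
      using b H_elt_image_inverse[of b c W] unfolding BH_rel_def by auto
  qed
  show "trans (BH_rel cj (Sigma_mat :: 'a^('n+'n)^('n+'n)))"
  proof (rule transI)
    fix W W' W'' :: "('a^('n+'n)) set"
    assume "(W, W') \<in> BH_rel cj Sigma_mat" "(W', W'') \<in> BH_rel cj Sigma_mat"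
    then obtain b b' where b: "b \<in> upper_borel" "W' = (\<lambda>v. H_elt cj b *v v) ` W"
      "b' \<in> upper_borel" "W'' = (\<lambda>v. H_elt cj b' *v v) ` W'" "W \<in> Lag" "W'' \<in> Lag"
      by (auto simp: BH_rel_def)
    then have "W'' = (\<lambda>v. H_elt cj (b' ** b) *v v) ` W"
      by (simp add: image_image H_elt_mult)
    then show "(W, W'') \<in> BH_rel cj Sigma_mat"
      using b upper_borel_mult unfolding BH_rel_def by blast
  qed
qed

end

subsection \<open>Signed partial permutations\<close>

text \<open>The only nonzero entry of row \<open>i\<close> stands in column \<open>\<pi> i\<close>.
  The column condition makes \<open>\<pi>\<close> injective, hence bijective by finiteness.\<close>

lemma signed_perms_iff:
  fixes s :: "int^'n::finite^'n"
  shows "s \<in> signed_perms \<longleftrightarrow>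
    (\<exists>\<pi> \<delta>. bij \<pi> \<and> (\<forall>i. \<delta> i \<in> {-1, 1}) \<and> s = (\<chi> i j. if j = \<pi> i then \<delta> i else 0))"
proof
  assume s: "s \<in> signed_perms"
  then have "\<forall>i. \<exists>j. s $ i $ j \<noteq> 0" by (simp add: signed_perms_def)
  then obtain \<pi> where \<pi>: "\<And>i. s $ i $ \<pi> i \<noteq> 0" by metis
  have row: "s $ i $ j \<noteq> 0 \<Longrightarrow> j = \<pi> i" for i j
    using s \<pi>[of i] by (auto simp: signed_perms_def SPP_def)
  have col: "s $ i $ j \<noteq> 0 \<Longrightarrow> s $ i' $ j \<noteq> 0 \<Longrightarrow> i = i'" for i i' j
    using s unfolding signed_perms_def SPP_def by blast
  have "inj \<pi>" using \<pi> col by (metis injI)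
  then have "bij \<pi>" by (simp add: bij_def finite_UNIV_inj_surj)
  moreover have "s $ i $ \<pi> i \<in> {-1, 1}" for i
    using s \<pi>[of i] by (auto simp: signed_perms_def SPP_def)
  moreover have "s = (\<chi> i j. if j = \<pi> i then s $ i $ \<pi> i else 0)"
    using row by (auto simp: vec_eq_iff)
  ultimately show "\<exists>\<pi> \<delta>. bij \<pi> \<and> (\<forall>i. \<delta> i \<in> {-1, 1}) \<and> s = (\<chi> i j. if j = \<pi> i then \<delta> i else 0)"
    by (intro exI[of _ \<pi>] exI[of _ "\<lambda>i. s $ i $ \<pi> i"]) auto
next
  assume "\<exists>\<pi> \<delta>. bij \<pi> \<and> (\<forall>i. \<delta> i \<in> {-1, 1}) \<and> s = (\<chi> i j. if j = \<pi> i then \<delta> i else 0)"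
  then obtain \<pi> \<delta> where bij: "bij \<pi>" and \<delta>: "\<And>i. \<delta> i \<in> {-1, 1}"
    and s: "s = (\<chi> i j. if j = \<pi> i then \<delta> i else 0)" by blast
  have "\<delta> i \<noteq> 0" for i using \<delta>[of i] by auto
  then show "s \<in> signed_perms"
    using \<delta> bij unfolding signed_perms_def SPP_def s
    by (auto simp: bij_def inj_eq)
qed

text \<open>Right multiplication by a signed permutation matrix just moves column \<open>j\<close>
  to \<open>\<pi> j\<close> and multiplies it by \<open>\<delta> j\<close>. With this entrywise
  form, matrix products disappear from the later arguments.\<close>

lemma Omega_rel_iff:
  fixes w w' :: "int^'n::finite^('n+'n)"
  shows "(w, w') \<in> Omega_rel \<longleftrightarrow> w \<in> Omega_circ \<and> w' \<in> Omega_circ \<and>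
    (\<exists>e \<delta> \<pi>. (\<forall>i. e i \<in> {-1, 1}) \<and> (\<forall>j. \<delta> j \<in> {-1, 1}) \<and> bij \<pi> \<and>
      (\<forall>k j. w' $ k $ \<pi> j = e (blk_idx k) * w $ k $ j * \<delta> j))"
proof -
  have "w' = sign_act e w ** (\<chi> i j. if j = \<pi> i then \<delta> i else 0) \<longleftrightarrow>
      (\<forall>k j. w' $ k $ \<pi> j = e (blk_idx k) * w $ k $ j * \<delta> j)" if "bij \<pi>" for e \<pi> \<delta>
  proof -
    have "(sign_act e w ** (\<chi> i j. if j = \<pi> i then \<delta> i else 0)) $ k $ \<pi> j
        = e (blk_idx k) * w $ k $ j * \<delta> j" for k j
      using that by (simp add: matrix_matrix_mult_def sign_act_def bij_def inj_eq if_distrib cong: if_cong)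
    moreover have "A = B \<longleftrightarrow> (\<forall>k j. A $ k $ \<pi> j = B $ k $ \<pi> j)" for A B :: "int^'n^('n+'n)"
      unfolding vec_eq_iff using that by (metis bij_pointE)
    ultimately show ?thesis by simp
  qed
  then show ?thesis
    unfolding Omega_rel_def signed_perms_iff by blast
qed

lemma Omega_relI:
  assumes "w \<in> Omega_circ" "w' \<in> Omega_circ" "\<And>i. e i \<in> {-1, 1}" "\<And>j. \<delta> j \<in> {-1, 1}" "bij \<pi>"
    "\<And>k j. w' $ k $ \<pi> j = e (blk_idx k) * w $ k $ j * \<delta> j"
  shows "(w, w') \<in> Omega_rel"
  unfolding Omega_rel_iff using assms by blast

lemma equiv_Omega_rel: "equiv (Omega_circ :: (int^'n::finite^('n+'n)) set) Omega_rel"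
proof (rule equivI)
  show "Omega_rel \<subseteq> (Omega_circ :: (int^'n::finite^('n+'n)) set) \<times> Omega_circ"
    by (auto simp: Omega_rel_def)
  show "refl_on (Omega_circ :: (int^'n::finite^('n+'n)) set) Omega_rel"
    by (rule refl_onI)
      (auto simp: Omega_rel_iff intro!: exI[of _ "\<lambda>_. 1"] exI[of _ id])
  show "sym (Omega_rel :: ((int^'n::finite^('n+'n)) \<times> _) set)"
  proof (rule symI)
    fix w w' :: "int^'n::finite^('n+'n)" assume "(w, w') \<in> Omega_rel"
    then obtain e \<delta> \<pi> where *: "w \<in> Omega_circ" "w' \<in> Omega_circ" "\<And>i. e i \<in> {-1, 1}"
      "\<And>j. \<delta> j \<in> {-1, 1}" "bij \<pi>" "\<And>k j. w' $ k $ \<pi> j = e (blk_idx k) * w $ k $ j * \<delta> j"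
      unfolding Omega_rel_iff by blast
    have "w $ k $ inv \<pi> j = e (blk_idx k) * w' $ k $ j * \<delta> (inv \<pi> j)" for k j
    proof -
      have "w' $ k $ j = e (blk_idx k) * w $ k $ inv \<pi> j * \<delta> (inv \<pi> j)"
        using *(6)[of k "inv \<pi> j"] \<open>bij \<pi>\<close> by (simp add: bij_def surj_f_inv_f)
      then show ?thesis
        using *(3)[of "blk_idx k"] *(4)[of "inv \<pi> j"] by auto
    qed
    then show "(w', w) \<in> Omega_rel"
      using * by (intro Omega_relI[of w' w e "\<lambda>j. \<delta> (inv \<pi> j)" "inv \<pi>"]) (auto simp: bij_imp_bij_inv)
  qed
  show "trans (Omega_rel :: ((int^'n::finite^('n+'n)) \<times> _) set)"
  proof (rule transI)
    fix w w' w'' :: "int^'n::finite^('n+'n)" assume "(w, w') \<in> Omega_rel" "(w', w'') \<in> Omega_rel"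
    then obtain e \<delta> \<pi> e' \<delta>' \<pi>' where
      *: "w \<in> Omega_circ" "\<And>i. e i \<in> {-1, 1}"
        "\<And>j. \<delta> j \<in> {-1, 1}" "bij \<pi>" "\<And>k j. w' $ k $ \<pi> j = e (blk_idx k) * w $ k $ j * \<delta> j" and
      **: "w'' \<in> Omega_circ" "\<And>i. e' i \<in> {-1, 1}"
        "\<And>j. \<delta>' j \<in> {-1, 1}" "bij \<pi>'" "\<And>k j. w'' $ k $ \<pi>' j = e' (blk_idx k) * w' $ k $ j * \<delta>' j"
      unfolding Omega_rel_iff by metis
    have sgn: "a * b \<in> {-1, 1}" if "a \<in> {-1, 1}" "b \<in> {-1, 1}" for a b :: int
      using that by auto
    show "(w, w'') \<in> Omega_rel"
      using * ** by (intro Omega_relI[of w w'' "\<lambda>i. e' i * e i" "\<lambda>j. \<delta> j * \<delta>' (\<pi> j)" "\<pi>' \<circ> \<pi>"] sgn)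
        (auto simp: bij_comp)
  qed
qed

section \<open>Representatives described by their entries\<close>

lemma mult_vec_single:
  fixes A :: "'a::semiring_1^'n::finite^'m::finite"
  assumes "\<And>j'. A $ k $ j' \<noteq> 0 \<Longrightarrow> j' = j"
  shows "(A *v c) $ k = A $ k $ j * c $ j"
proof -
  have "(\<Sum>j'\<in>UNIV. A $ k $ j' * c $ j') = (\<Sum>j'\<in>UNIV. if j' = j then A $ k $ j * c $ j else 0)"
    using assms by (intro sum.cong refl) (metis mult_zero_left)
  then show ?thesis by (simp add: matrix_vector_mult_def)
qed

text \<open>Choose a nonzero entry in column \<open>j\<close>. It is alone in its row, so that row
  of the product recovers \<open>c $ j\<close> up to a nonzero integer factor.\<close>

lemma inj_mult_vec_rows:
  fixes w :: "int^'n::finite^'m::finite"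
  assumes row: "\<And>k j j'. w $ k $ j \<noteq> 0 \<Longrightarrow> w $ k $ j' \<noteq> 0 \<Longrightarrow> j = j'"
    and col: "\<And>j. \<exists>k. w $ k $ j \<noteq> 0"
  shows "inj ((*v) (map_matrix (of_int :: int \<Rightarrow> 'a::field_char_0) w))"
proof (rule injI)
  fix c d assume eq: "map_matrix (of_int :: int \<Rightarrow> 'a) w *v c = map_matrix of_int w *v d"
  have "c $ j = d $ j" for j
  proof -
    obtain k where k: "w $ k $ j \<noteq> 0" using col by blast
    have "(map_matrix (of_int :: int \<Rightarrow> 'a) w *v x) $ k = of_int (w $ k $ j) * x $ j" for x
      using mult_vec_single[of "map_matrix (of_int :: int \<Rightarrow> 'a) w" k j x] row k by (simp add: map_matrix_def)
    then show ?thesis using eq k by (metis mult_left_cancel of_int_eq_0_iff)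
  qed
  then show "c = d" by (simp add: vec_eq_iff)
qed

text \<open>As each row has at most one nonzero entry, full rank means that no column vanishes: a
  zero column gives a kernel vector, and otherwise \<open>inj_mult_vec_rows\<close> applies. In this
  form the condition no longer mentions a field.\<close>

lemma Omega_circ_iff:
  fixes w :: "int^'n::finite^('n+'n)"
  shows "w \<in> Omega_circ \<longleftrightarrow>
    (\<forall>k j. w $ k $ j \<in> {-1, 0, 1}) \<and>
    (\<forall>k j j'. w $ k $ j \<noteq> 0 \<and> w $ k $ j' \<noteq> 0 \<longrightarrow> j = j') \<and>
    (\<forall>i i' j. w $ Inl i $ j \<noteq> 0 \<and> w $ Inl i' $ j \<noteq> 0 \<longrightarrow> i = i') \<and>
    (\<forall>i i' j. w $ Inr i $ j \<noteq> 0 \<and> w $ Inr i' $ j \<noteq> 0 \<longrightarrow> i = i') \<and>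
    (\<forall>j j'. (\<Sum>i\<in>UNIV. w $ Inl i $ j * w $ Inr i $ j') = (\<Sum>i\<in>UNIV. w $ Inl i $ j' * w $ Inr i $ j)) \<and>
    (\<forall>j. \<exists>k. w $ k $ j \<noteq> 0)" (is "_ \<longleftrightarrow> ?R")
proof -
  have sym: "transpose (transpose (top_blk w) ** bot_blk w) = transpose (top_blk w) ** bot_blk w \<longleftrightarrow>
     (\<forall>j j'. (\<Sum>i\<in>UNIV. w $ Inl i $ j * w $ Inr i $ j') = (\<Sum>i\<in>UNIV. w $ Inl i $ j' * w $ Inr i $ j))"
    by (auto simp: vec_eq_iff transpose_def matrix_matrix_mult_def top_blk_def bot_blk_def)
  have split_sum: "(\<forall>k. P k) \<longleftrightarrow> (\<forall>i. P (Inl i)) \<and> (\<forall>i. P (Inr i))" for P :: "'n + 'n \<Rightarrow> bool"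
    by (metis sum.exhaust)
  have "\<exists>k. w $ k $ j \<noteq> 0" if "rank (map_matrix (of_int :: int \<Rightarrow> real) w) = CARD('n)" for j
  proof (rule ccontr)
    assume "\<nexists>k. w $ k $ j \<noteq> 0"
    then have "map_matrix (of_int :: int \<Rightarrow> real) w *v axis j 1 = map_matrix of_int w *v 0"
      by (auto simp: vec_eq_iff matrix_vector_mult_def axis_def map_matrix_def if_distrib cong: if_cong)
    then have "axis j (1::real) = 0"
      using that unfolding full_rank_injective by (metis injD)
    then show False by (metis axis_eq_0_iff zero_neq_one)
  qed
  moreover have "rank (map_matrix (of_int :: int \<Rightarrow> real) w) = CARD('n)" if ?R
    unfolding full_rank_injective using that by (intro inj_mult_vec_rows) blast+
  ultimately show ?thesis
    unfolding Omega_circ_def SPP_def mem_Collect_eq sym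
    unfolding split_sum[of "\<lambda>k. \<forall>j. w $ k $ j \<in> _"] split_sum[of "\<lambda>k. \<forall>j j'. w $ k $ j \<noteq> 0 \<and> w $ k $ j' \<noteq> 0 \<longrightarrow> j = j'"]
      top_blk_def bot_blk_def vec_lambda_beta
    by (intro iffI conjI; (elim conjE)?; (assumption | blast)?)
qed

context
  fixes w :: "int^'n::finite^('n+'n)"
  assumes w: "w \<in> Omega_circ"
begin

lemma Omega_entry: "w $ k $ j \<in> {-1, 0, 1}"
  and Omega_row: "w $ k $ j \<noteq> 0 \<Longrightarrow> w $ k $ j' \<noteq> 0 \<Longrightarrow> j = j'"
  and Omega_top: "w $ Inl i $ j \<noteq> 0 \<Longrightarrow> w $ Inl i' $ j \<noteq> 0 \<Longrightarrow> i = i'"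
  and Omega_bot: "w $ Inr i $ j \<noteq> 0 \<Longrightarrow> w $ Inr i' $ j \<noteq> 0 \<Longrightarrow> i = i'"
  and Omega_sym: "(\<Sum>i\<in>UNIV. w $ Inl i $ j * w $ Inr i $ j') = (\<Sum>i\<in>UNIV. w $ Inl i $ j' * w $ Inr i $ j)"
  and Omega_col: "\<exists>k. w $ k $ j \<noteq> 0"
proof -
  note 1 = w[unfolded Omega_circ_iff]
  show "w $ k $ j \<in> {-1, 0, 1}" using conjunct1[OF 1] by blast
  note 2 = conjunct2[OF 1]
  show "w $ k $ j \<noteq> 0 \<Longrightarrow> w $ k $ j' \<noteq> 0 \<Longrightarrow> j = j'" using conjunct1[OF 2] by blast
  note 3 = conjunct2[OF 2]
  show "w $ Inl i $ j \<noteq> 0 \<Longrightarrow> w $ Inl i' $ j \<noteq> 0 \<Longrightarrow> i = i'" using conjunct1[OF 3] by blast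
  note 4 = conjunct2[OF 3]
  show "w $ Inr i $ j \<noteq> 0 \<Longrightarrow> w $ Inr i' $ j \<noteq> 0 \<Longrightarrow> i = i'" using conjunct1[OF 4] by blast
  note 5 = conjunct2[OF 4]
  show "(\<Sum>i\<in>UNIV. w $ Inl i $ j * w $ Inr i $ j') = (\<Sum>i\<in>UNIV. w $ Inl i $ j' * w $ Inr i $ j)"
    using conjunct1[OF 5] by (elim allE)
  show "\<exists>k. w $ k $ j \<noteq> 0" using conjunct2[OF 5] by blast
qed

text \<open>A column has at most one nonzero entry in each block, so both sums in the symmetry
  condition collapse to one term.\<close>

lemma Omega_sym_single:
  assumes "w $ Inl i $ j \<noteq> 0" "w $ Inr i' $ j \<noteq> 0"
  shows "w $ Inl i $ j * w $ Inr i $ j' = w $ Inl i' $ j' * w $ Inr i' $ j"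
proof -
  have "(\<Sum>l\<in>UNIV. w $ Inl l $ j * w $ Inr l $ j') = w $ Inl i $ j * w $ Inr i $ j'"
    using Omega_top[OF assms(1)] by (subst sum.mono_neutral_right[of _ "{i}"]) auto
  moreover have "(\<Sum>l\<in>UNIV. w $ Inl l $ j' * w $ Inr l $ j) = w $ Inl i' $ j' * w $ Inr i' $ j"
    using Omega_bot[OF assms(2)] by (subst sum.mono_neutral_right[of _ "{i'}"]) auto
  ultimately show ?thesis using Omega_sym[of j j'] by simp
qed

lemma Omega_mult_vec:
  assumes "w $ k $ j \<noteq> 0"
  shows "(map_matrix (of_int :: int \<Rightarrow> 'a::field_char_0) w *v c) $ k = of_int (w $ k $ j) * c $ j"
  using mult_vec_single[of "map_matrix (of_int :: int \<Rightarrow> 'a) w" k j c] Omega_row[OF assms]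
  by (simp add: map_matrix_def) 

lemma Omega_mult_vec_zero:
  assumes "\<And>j. w $ k $ j = 0"
  shows "(map_matrix (of_int :: int \<Rightarrow> 'a::field_char_0) w *v c) $ k = 0"
  using assms by (simp add: map_matrix_def matrix_vector_mult_def)

lemma inj_Omega_mult_vec: "inj ((*v) (map_matrix (of_int :: int \<Rightarrow> 'a::field_char_0) w))"
  by (intro inj_mult_vec_rows Omega_row Omega_col)

end

section \<open>Column spaces of representatives\<close>

context involutive_field
begin

lemma colspace_Lag:
  fixes w :: "int^'n::finite^('n+'n)"
  assumes w: "w \<in> Omega_circ"
  shows "colspace w \<in> Lag"
proof -
  let ?A = "map_matrix (of_int :: int \<Rightarrow> 'a) w"
  have "vec.subspace (range ((*v) ?A))"
    by (rule vec.linear_subspace_image) (auto simp: vec.subspace_UNIV)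
  moreover have "vec.dim (range ((*v) ?A)) = CARD('n)"
    using vec.dim_image_eq[of "(*v) ?A" UNIV] inj_Omega_mult_vec[OF w, where 'a='a]
      vec_dim_card[where 'n='n and 'a='a] by (simp del: vec.dim_UNIV)
  moreover have "sform cj Sigma_mat (?A *v c) (?A *v d) = 0" for c d
  proof -
    define T where "T = (\<chi> i j. (of_int (w $ Inl i $ j) :: 'a))"
    define B where "B = (\<chi> i j. (of_int (w $ Inr i $ j) :: 'a))"
    have A: "?A *v c = join_vec (T *v c) (B *v c)" for c
      by (auto simp: vec_eq_iff join_vec_def T_def B_def matrix_vector_mult_def map_matrix_def split: sum.split)
    \<comment> \<open>Integers are fixed by \<open>cj\<close>, so isotropy of the column space is
      exactly the symmetry condition on the integer blocks.\<close>
    have "conj_transpose cj B ** T = conj_transpose cj T ** B"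
    proof -
      have "(conj_transpose cj B ** T) $ j $ j' = of_int (\<Sum>i\<in>UNIV. w $ Inl i $ j' * w $ Inr i $ j)" for j j'
        by (simp add: matrix_matrix_mult_def conj_transpose_def T_def B_def mult.commute)
      moreover have "(conj_transpose cj T ** B) $ j $ j' = of_int (\<Sum>i\<in>UNIV. w $ Inl i $ j * w $ Inr i $ j')" for j j'
        by (simp add: matrix_matrix_mult_def conj_transpose_def T_def B_def)
      ultimately show ?thesis using Omega_sym[OF w] by (simp add: vec_eq_iff)
    qed
    moreover have "pairing cj (X *v c) (Y *v d) = pairing cj c ((conj_transpose cj X ** Y) *v d)" for X Y :: "'a^'n^'n"
    proof -
      have "conj_transpose cj (conj_transpose cj X) = X"
        by (simp add: conj_transpose_def vec_eq_iff)
      then show ?thesis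
        using pairing_adjoint[of "conj_transpose cj X" c "Y *v d"] by (simp add: matrix_vector_mul_assoc)
    qed
    ultimately show ?thesis by (simp add: A sform_Sigma)
  qed
  ultimately show ?thesis
    by (auto simp: LagGr_def colspace_def)
qed

text \<open>Column operations do not change the column space. The row signs are realised by the
  diagonal matrix \<open>b\<close>, which equals its inverse and its adjoint and therefore acts by
  the same signs on both blocks.\<close>

lemma Omega_rel_imp_BH_rel:
  fixes w w' :: "int^'n::{finite,linorder}^('n+'n)"
  assumes "(w, w') \<in> Omega_rel"
  shows "(colspace w, colspace w') \<in> BH_rel cj Sigma_mat"
proof -
  obtain e \<delta> \<pi> where *: "w \<in> Omega_circ" "w' \<in> Omega_circ" "\<And>i. e i \<in> {-1, 1}"
    "\<And>j. \<delta> j \<in> {-1, 1}" "bij \<pi>" "\<And>k j. w' $ k $ \<pi> j = e (blk_idx k) * w $ k $ j * \<delta> j"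
    using assms unfolding Omega_rel_iff by blast
  define b :: "(('a,'n) vec, 'n) vec" where "b = (\<chi> i j. if i = j then of_int (e i) else 0)"
  have e2: "of_int (e i) * of_int (e i) = (1::'a)" for i using *(3)[of i] by auto
  have \<delta>2: "of_int (\<delta> i) * of_int (\<delta> i) = (1::'a)" for i using *(4)[of i] by auto
  have b: "b \<in> upper_borel"
  proof (rule upper_borelI)
    show "b $ i $ i \<noteq> 0" for i using *(3)[of i] by (auto simp: b_def)
  qed (auto simp: b_def)
  have bb: "b ** b = mat 1"
    by (simp add: b_def matrix_matrix_mult_def mat_def vec_eq_iff e2 if_distrib[of "\<lambda>c. c * _"] cong: if_cong)
  have bv: "(b *v x) $ i = of_int (e i) * x $ i" for x i
    by (simp add: b_def matrix_vector_mult_def if_distrib[of "\<lambda>c. c * _"] cong: if_cong)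
  have cb: "conj_transpose cj b = b"
    by (auto simp: b_def conj_transpose_def vec_eq_iff)
  have H: "(H_elt cj b *v v) $ k = of_int (e (blk_idx k)) * v $ k" for v k
    by (cases v rule: join_vec_cases; cases k) (simp_all add: H_elt_inverse[OF bb] cb bv blk_idx_def)
  have key: "H_elt cj b *v (map_matrix of_int w *v c)
      = map_matrix of_int w' *v (\<chi> j. of_int (\<delta> (inv \<pi> j)) * c $ inv \<pi> j)" for c :: "('a,'n) vec"
  proof (subst vec_eq_iff, rule allI)
    fix k
    have "(map_matrix of_int w' *v (\<chi> j. of_int (\<delta> (inv \<pi> j)) * c $ inv \<pi> j)) $ k
       = (\<Sum>j\<in>UNIV. of_int (w' $ k $ j) * (of_int (\<delta> (inv \<pi> j)) * c $ inv \<pi> j))"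
      by (simp add: matrix_vector_mult_def map_matrix_def)
    also have "\<dots> = (\<Sum>j\<in>UNIV. of_int (w' $ k $ \<pi> j) * (of_int (\<delta> j) * c $ j))"
      using \<open>bij \<pi>\<close> by (subst sum.reindex_bij_betw[OF \<open>bij \<pi>\<close>, symmetric]) (simp add: bij_def)
    also have "\<dots> = (\<Sum>j\<in>UNIV. of_int (e (blk_idx k)) * (of_int (w $ k $ j) * c $ j))"
      using \<delta>2 by (intro sum.cong refl) (simp add: * algebra_simps)
    also have "\<dots> = (H_elt cj b *v (map_matrix of_int w *v c)) $ k"
      by (subst H) (simp add: matrix_vector_mult_def map_matrix_def sum_distrib_left)
    finally show "(H_elt cj b *v (map_matrix of_int w *v c)) $ k
      = (map_matrix of_int w' *v (\<chi> j. of_int (\<delta> (inv \<pi> j)) * c $ inv \<pi> j)) $ k" by simp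
  qed
  have "colspace w' = (\<lambda>v. H_elt cj b *v v) ` (colspace w :: ('a,'n+'n) vec set)"
  proof
    show "(\<lambda>v. H_elt cj b *v v) ` (colspace w :: ('a,'n+'n) vec set) \<subseteq> colspace w'"
      unfolding colspace_def image_image key by blast
    show "colspace w' \<subseteq> (\<lambda>v. H_elt cj b *v v) ` (colspace w :: ('a,'n+'n) vec set)"
    proof
      fix v :: "('a,'n+'n) vec" assume "v \<in> colspace w'"
      then obtain d where v: "v = map_matrix of_int w' *v d" by (auto simp: colspace_def)
      define c where "c = (\<chi> j. of_int (\<delta> j) * d $ \<pi> j)"
      have "(\<chi> j. of_int (\<delta> (inv \<pi> j)) * c $ inv \<pi> j) = d"
        using \<open>bij \<pi>\<close> \<delta>2 by (simp add: c_def vec_eq_iff bij_def surj_f_inv_f mult.assoc[symmetric])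
      then have "v = H_elt cj b *v (map_matrix of_int w *v c)"
        by (simp only: key v)
      then show "v \<in> (\<lambda>v. H_elt cj b *v v) ` (colspace w :: ('a,'n+'n) vec set)"
        unfolding colspace_def by (rule image_eqI) (rule rangeI)
    qed
  qed
  then show ?thesis
    using b * colspace_Lag unfolding BH_rel_def by blast
qed

end

subsection \<open>Injectivity\<close>

lemma sum_mult_of_int_single:
  fixes f :: "'n::finite \<Rightarrow> 'a::ring_1"
  assumes "\<And>i. i \<noteq> p \<Longrightarrow> x i = 0"
  shows "(\<Sum>i\<in>UNIV. f i * of_int (x i)) = f p * of_int (x p)"
  using assms by (subst sum.mono_neutral_right[of _ "{p}"]) auto

context involutive_field
begin

lemma upper_diag_inverse:
  fixes b c :: "(('a, 'n::{finite,linorder}) vec, 'n) vec"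
  assumes "b \<in> upper_borel" "c \<in> upper_borel" "b ** c = mat 1"
  shows "b $ i $ i * c $ i $ i = 1"
proof -
  have "(b ** c) $ i $ i = (b *v (\<chi> k. c $ k $ i)) $ i"
    by (simp add: matrix_matrix_mult_def matrix_vector_mult_def)
  also have "\<dots> = b $ i $ i * c $ i $ i"
    using assms by (subst upper_mult_vec_lead) (auto simp: upper_borel_def)
  finally show ?thesis using assms by (simp add: mat_def)
qed

lemma norm_sign_eq_1:
  assumes "u * cj u = of_int s" "s \<in> {-1, 1}"
  shows "s = 1"
  using assms norm_neq_m1[of u] by auto

text \<open>If row \<open>q\<close> of the upper block were zero, then \<open>(0, e_q)\<close> would
  be orthogonal to the column space and hence lie in it. The coefficient of column \<open>j\<close>
  would then be nonzero by the lower row \<open>q\<close> and zero by the upper row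
  \<open>p\<close>. Symmetry locates the lower entry of the column \<open>j'\<close> so
  found.\<close>

lemma Omega_partner:
  fixes w :: "int^'n::finite^('n+'n)"
  assumes w: "w \<in> Omega_circ" and p: "w $ Inl p $ j \<noteq> 0" and q: "w $ Inr q $ j \<noteq> 0"
  obtains j' where "w $ Inl q $ j' \<noteq> 0" "w $ Inr p $ j' \<noteq> 0"
    "w $ Inl p $ j * w $ Inr p $ j' = w $ Inl q $ j' * w $ Inr q $ j"
proof -
  note sym = Omega_sym_single[OF w p q]
  have "\<exists>j'. w $ Inl q $ j' \<noteq> 0"
  proof (rule ccontr)
    assume none: "\<nexists>j'. w $ Inl q $ j' \<noteq> 0"
    have "join_vec 0 (axis q 1) \<in> (colspace w :: ('a, 'n + 'n) vec set)"
    proof (rule Lag_maximal[OF colspace_Lag[OF w]])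
      fix x y :: "('a, 'n) vec" assume "join_vec x y \<in> colspace w"
      then obtain c where c: "join_vec x y = map_matrix of_int w *v c" by (auto simp: colspace_def)
      have "x $ q = join_vec x y $ Inl q" by simp
      also have "\<dots> = 0" unfolding c using none by (intro Omega_mult_vec_zero[OF w]) auto
      finally show "pairing cj x (axis q 1) = pairing cj y 0"
        by (simp add: pairing_axis_right)
    qed
    then obtain c where c: "join_vec 0 (axis q (1::'a)) = map_matrix of_int w *v c"
      by (auto simp: colspace_def)
    have "of_int (w $ Inr q $ j) * c $ j = 1"
      using Omega_mult_vec[OF w q, of c] unfolding c[symmetric] by simp
    moreover have "of_int (w $ Inl p $ j) * c $ j = 0"
      using Omega_mult_vec[OF w p, of c] unfolding c[symmetric] by simp
    ultimately show False using p by simp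
  qed
  then obtain j' where j': "w $ Inl q $ j' \<noteq> 0" by blast
  moreover have "w $ Inr p $ j' \<noteq> 0"
    using sym[of j'] j' q by auto
  ultimately show ?thesis using that sym by blast
qed

section \<open>Comparing the columns of equivalent representatives\<close>

lemma BH_rel_column:
  fixes w w' :: "int^'n::{finite,linorder}^('n+'n)"
  assumes rel: "(colspace w, colspace w') \<in> BH_rel cj Sigma_mat"
  obtains b c d where "b \<in> upper_borel" "c \<in> upper_borel" "b ** c = mat 1"
    "\<And>k. (map_matrix of_int w' *v d) $ Inl k = (\<Sum>i\<in>UNIV. b $ k $ i * of_int (w $ Inl i $ j))"
    "\<And>k. (map_matrix of_int w' *v d) $ Inr k = (\<Sum>i\<in>UNIV. cj (c $ i $ k) * of_int (w $ Inr i $ j))"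
proof -
  obtain b where b: "b \<in> upper_borel"
      "colspace w' = (\<lambda>v. H_elt cj b *v v) ` (colspace w :: ('a, 'n + 'n) vec set)"
    using rel by (auto simp: BH_rel_def)
  obtain c where c: "c \<in> upper_borel" "b ** c = mat 1" "c ** b = mat 1"
    using upper_borel_inverse[OF b(1)] by metis
  let ?x = "(\<chi> i. of_int (w $ Inl i $ j)) :: ('a, 'n) vec" and ?y = "(\<chi> i. of_int (w $ Inr i $ j)) :: ('a, 'n) vec"
  have "(map_matrix of_int w *v axis j 1) $ k = (of_int (w $ k $ j) :: 'a)" for k
    by (simp add: matrix_vector_mult_def axis_def map_matrix_def if_distrib cong: if_cong)
  then have "map_matrix of_int w *v axis j 1 = join_vec ?x ?y"
    by (auto simp: vec_eq_iff join_vec_def split: sum.split)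
  then have "join_vec ?x ?y \<in> colspace w" by (metis colspace_def rangeI)
  then have "H_elt cj b *v join_vec ?x ?y \<in> colspace w'" using b(2) by blast
  then obtain d where "map_matrix of_int w' *v d = join_vec (b *v ?x) (conj_transpose cj c *v ?y)"
    by (auto simp: colspace_def H_elt_inverse[OF c(2)])
  then show ?thesis
    by (intro that[OF b(1) c(1,2), of d]) (simp_all add: matrix_vector_mult_def conj_transpose_def)
qed

text \<open>The upper block of the image is nonzero at \<open>p\<close>, so the column
  \<open>j'\<close> of \<open>w'\<close> meeting that row has a nonzero coefficient. Every lower
  entry of column \<open>j'\<close> is then visible in the image, whose lower block starts no
  earlier than that of column \<open>j\<close>. If both columns also have a lower entry at
  \<open>p\<close>, the two blocks give the same coefficient, and this equates
  \<open>b_pp * cj b_pp\<close> with a product of four signs.\<close>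

lemma BH_rel_column_top:
  fixes w w' :: "int^'n::{finite,linorder}^('n+'n)"
  assumes rel: "(colspace w, colspace w') \<in> BH_rel cj Sigma_mat"
    and w: "w \<in> Omega_circ" and w': "w' \<in> Omega_circ" and p: "w $ Inl p $ j \<noteq> 0"
  obtains j' where "w' $ Inl p $ j' \<noteq> 0"
    "\<And>q'. w' $ Inr q' $ j' \<noteq> 0 \<Longrightarrow> \<exists>q\<le>q'. w $ Inr q $ j \<noteq> 0"
    "w $ Inr p $ j \<noteq> 0 \<Longrightarrow> w' $ Inr p $ j' \<noteq> 0 \<Longrightarrow>
      w $ Inl p $ j * w $ Inr p $ j = w' $ Inl p $ j' * w' $ Inr p $ j'"
proof -
  obtain b c d where b: "b \<in> upper_borel" "c \<in> upper_borel" "b ** c = mat 1"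
    and top: "\<And>k. (map_matrix of_int w' *v d) $ Inl k = (\<Sum>i\<in>UNIV. b $ k $ i * of_int (w $ Inl i $ j))"
    and bot: "\<And>k. (map_matrix of_int w' *v d) $ Inr k = (\<Sum>i\<in>UNIV. cj (c $ i $ k) * of_int (w $ Inr i $ j))"
    by (rule BH_rel_column[OF rel, where j = j]) (erule that; assumption)
  have top': "(map_matrix of_int w' *v d) $ Inl k = b $ k $ p * of_int (w $ Inl p $ j)" for k
    unfolding top using Omega_top[OF w p] by (intro sum_mult_of_int_single) blast
  have bot': "(map_matrix of_int w' *v d) $ Inr k = cj (c $ q $ k) * of_int (w $ Inr q $ j)"
    if "w $ Inr q $ j \<noteq> 0" for q k
    unfolding bot using Omega_bot[OF w that] by (intro sum_mult_of_int_single) blast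
  have nz: "b $ p $ p * of_int (w $ Inl p $ j) \<noteq> 0"
    using upper_borel_diag_nz[OF b(1), of p] p by simp
  then obtain j' where j': "w' $ Inl p $ j' \<noteq> 0"
    using Omega_mult_vec_zero[OF w', of "Inl p" d] top'[of p] by metis
  have dj: "of_int (w' $ Inl p $ j') * d $ j' = b $ p $ p * of_int (w $ Inl p $ j)"
    using Omega_mult_vec[OF w' j', of d] top'[of p] by simp
  then have d0: "d $ j' \<noteq> 0" using nz by auto
  show ?thesis
  proof (rule that[OF j'])
    fix q' assume q': "w' $ Inr q' $ j' \<noteq> 0"
    then have "(map_matrix of_int w' *v d) $ Inr q' \<noteq> 0"
      using Omega_mult_vec[OF w' q', of d] d0 by simp
    then obtain q where q: "cj (c $ q $ q') * of_int (w $ Inr q $ j) \<noteq> 0"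
      unfolding bot by (meson sum.neutral)
    then have "q \<le> q'" using b(2) by (auto simp: upper_borel_def not_less[symmetric])
    then show "\<exists>q\<le>q'. w $ Inr q $ j \<noteq> 0" using q by auto
  next
    assume pj: "w $ Inr p $ j \<noteq> 0" and pj': "w' $ Inr p $ j' \<noteq> 0"
    have dj': "of_int (w' $ Inr p $ j') * d $ j' = cj (c $ p $ p) * of_int (w $ Inr p $ j)"
      using Omega_mult_vec[OF w' pj', of d] bot'[OF pj, of p] by simp
    have sgn: "w $ Inl p $ j \<in> {-1, 1}" "w $ Inr p $ j \<in> {-1, 1}" "w' $ Inl p $ j' \<in> {-1, 1}" "w' $ Inr p $ j' \<in> {-1, 1}"
      using Omega_entry[OF w, of "Inl p" j] Omega_entry[OF w, of "Inr p" j]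
        Omega_entry[OF w', of "Inl p" j'] Omega_entry[OF w', of "Inr p" j'] p pj j' pj' by auto
    define s where "s = w $ Inl p $ j * w $ Inr p $ j * (w' $ Inl p $ j' * w' $ Inr p $ j')"
    have bc: "cj (b $ p $ p) * cj (c $ p $ p) = 1"
      using upper_diag_inverse[OF b, of p] by (metis cj_1 cj_mult)
    have "d $ j' = of_int (w' $ Inl p $ j') * (of_int (w' $ Inl p $ j') * d $ j')"
      using sgn(3) by auto
    then have "d $ j' = of_int (w' $ Inl p $ j' * w $ Inl p $ j) * b $ p $ p"
      unfolding dj by (simp add: mult_ac)
    then have "of_int (w' $ Inr p $ j' * w' $ Inl p $ j' * w $ Inl p $ j) * b $ p $ p
        = cj (c $ p $ p) * of_int (w $ Inr p $ j)"
      using dj' by (simp add: mult_ac)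
    \<comment> \<open>Multiplying by \<open>cj (b $ p $ p)\<close> eliminates \<open>c\<close>,
      whose diagonal entries are inverse to those of \<open>b\<close>.\<close>
    then have "of_int (w' $ Inr p $ j' * w' $ Inl p $ j' * w $ Inl p $ j) * (b $ p $ p * cj (b $ p $ p))
        = (cj (b $ p $ p) * cj (c $ p $ p)) * of_int (w $ Inr p $ j)"
      by (simp add: mult_ac)
    then have "of_int (w' $ Inr p $ j' * w' $ Inl p $ j' * w $ Inl p $ j) * (b $ p $ p * cj (b $ p $ p))
        = of_int (w $ Inr p $ j)"
      by (simp only: bc mult_1)
    moreover have "u = of_int (t * v)" if "of_int t * u = of_int v" "t \<in> {-1, 1}" for u :: 'a and t v
      using that(2) by (auto simp flip: that(1))
    moreover have "w' $ Inr p $ j' * w' $ Inl p $ j' * w $ Inl p $ j \<in> {-1, 1}" using sgn by auto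
    ultimately have "b $ p $ p * cj (b $ p $ p)
        = of_int (w' $ Inr p $ j' * w' $ Inl p $ j' * w $ Inl p $ j * w $ Inr p $ j)" by blast
    then have "b $ p $ p * cj (b $ p $ p) = of_int s"
      by (simp only: s_def mult_ac)
    moreover have "s \<in> {-1, 1}" using sgn by (auto simp: s_def)
    ultimately have "s = 1" by (rule norm_sign_eq_1)
    then show "w $ Inl p $ j * w $ Inr p $ j = w' $ Inl p $ j' * w' $ Inr p $ j'"
      using sgn by (auto simp: s_def)
  qed
qed

text \<open>The image of a column without upper entry has zero upper block. A column of
  \<open>w'\<close> that occurs in it with nonzero coefficient cannot have an upper entry, since
  nothing else in that row could cancel it.\<close>

lemma BH_rel_column_bot:
  fixes w w' :: "int^'n::{finite,linorder}^('n+'n)"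
  assumes rel: "(colspace w, colspace w') \<in> BH_rel cj Sigma_mat"
    and w: "w \<in> Omega_circ" and w': "w' \<in> Omega_circ"
    and q: "w $ Inr q $ j \<noteq> 0" and p: "\<And>p. w $ Inl p $ j = 0"
  obtains j' where "w' $ Inr q $ j' \<noteq> 0" "\<And>p. w' $ Inl p $ j' = 0"
proof -
  obtain b c d where b: "b \<in> upper_borel" "c \<in> upper_borel" "b ** c = mat 1"
    and top: "\<And>k. (map_matrix of_int w' *v d) $ Inl k = (\<Sum>i\<in>UNIV. b $ k $ i * of_int (w $ Inl i $ j))"
    and bot: "\<And>k. (map_matrix of_int w' *v d) $ Inr k = (\<Sum>i\<in>UNIV. cj (c $ i $ k) * of_int (w $ Inr i $ j))"
    by (rule BH_rel_column[OF rel, where j = j]) (erule that; assumption)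
  have "(map_matrix of_int w' *v d) $ Inr q = cj (c $ q $ q) * of_int (w $ Inr q $ j)"
    unfolding bot using Omega_bot[OF w q] by (intro sum_mult_of_int_single) blast
  then have nz: "(map_matrix of_int w' *v d) $ Inr q \<noteq> 0"
    using upper_borel_diag_nz[OF b(2), of q] q by simp
  then obtain j' where j': "w' $ Inr q $ j' \<noteq> 0"
    using Omega_mult_vec_zero[OF w', of "Inr q" d] by metis
  then have d0: "d $ j' \<noteq> 0"
    using Omega_mult_vec[OF w' j', of d] nz by auto
  have "w' $ Inl p $ j' = 0" for p
  proof (rule ccontr)
    assume nz: "w' $ Inl p $ j' \<noteq> 0"
    have "(map_matrix of_int w' *v d) $ Inl p = 0"
      using p by (simp add: top)
    then show False using Omega_mult_vec[OF w' nz, of d] nz d0 by simp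
  qed
  then show ?thesis using that j' by blast
qed

lemma BH_rel_column_support:
  fixes w w' :: "int^'n::{finite,linorder}^('n+'n)"
  assumes rel: "(colspace w, colspace w') \<in> BH_rel cj Sigma_mat"
    and w: "w \<in> Omega_circ" and w': "w' \<in> Omega_circ"
  obtains j' where "\<And>k. w $ k $ j \<noteq> 0 \<longleftrightarrow> w' $ k $ j' \<noteq> 0"
    "\<And>p. w $ Inl p $ j \<noteq> 0 \<Longrightarrow> w $ Inr p $ j \<noteq> 0 \<Longrightarrow>
      w $ Inl p $ j * w $ Inr p $ j = w' $ Inl p $ j' * w' $ Inr p $ j'"
proof (cases "\<exists>p. w $ Inl p $ j \<noteq> 0")
  case True
  have rel': "(colspace w', colspace w) \<in> BH_rel cj Sigma_mat"
    using rel equiv_BH_rel by (meson equiv_def symD)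
  obtain p where p: "w $ Inl p $ j \<noteq> 0" using True by blast
  obtain j' where j': "w' $ Inl p $ j' \<noteq> 0"
    "\<And>q'. w' $ Inr q' $ j' \<noteq> 0 \<Longrightarrow> \<exists>q\<le>q'. w $ Inr q $ j \<noteq> 0"
    "w $ Inr p $ j \<noteq> 0 \<Longrightarrow> w' $ Inr p $ j' \<noteq> 0 \<Longrightarrow>
      w $ Inl p $ j * w $ Inr p $ j = w' $ Inl p $ j' * w' $ Inr p $ j'"
    using BH_rel_column_top[OF rel w w' p] by metis
  \<comment> \<open>The comparison in the reverse direction leads to a column with upper entry at
    \<open>p\<close>, which can only be \<open>j\<close>. The two inequalities between lower
    positions then give equality.\<close>
  obtain l where "w $ Inl p $ l \<noteq> 0"
    "\<And>q'. w $ Inr q' $ l \<noteq> 0 \<Longrightarrow> \<exists>q\<le>q'. w' $ Inr q $ j' \<noteq> 0"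
    using BH_rel_column_top[OF rel' w' w j'(1)] by metis
  then have geq: "\<exists>q\<le>q'. w' $ Inr q $ j' \<noteq> 0" if "w $ Inr q' $ j \<noteq> 0" for q'
    using that Omega_row[OF w p] by metis
  have bot: "w $ Inr q $ j \<noteq> 0 \<longleftrightarrow> w' $ Inr q $ j' \<noteq> 0" for q
    using j'(2) geq Omega_bot[OF w] Omega_bot[OF w'] by (metis order_antisym)
  have "w $ Inl q $ j \<noteq> 0 \<longleftrightarrow> w' $ Inl q $ j' \<noteq> 0" for q
    using p j'(1) Omega_top[OF w] Omega_top[OF w'] by metis
  then have "w $ k $ j \<noteq> 0 \<longleftrightarrow> w' $ k $ j' \<noteq> 0" for k
    using bot by (cases k) auto
  then show ?thesis
    using that[of j'] j'(3) Omega_top[OF w p] by metis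
next
  case False
  then have top: "\<And>p. w $ Inl p $ j = 0" by blast
  obtain k where k: "w $ k $ j \<noteq> 0" using Omega_col[OF w] by blast
  then obtain q where q: "w $ Inr q $ j \<noteq> 0" using top by (cases k) auto
  obtain j' where j': "w' $ Inr q $ j' \<noteq> 0" "\<And>p. w' $ Inl p $ j' = 0"
    using BH_rel_column_bot[OF rel w w' q top] by metis
  have "w $ Inr i $ j \<noteq> 0 \<longleftrightarrow> w' $ Inr i $ j' \<noteq> 0" for i
    using q j'(1) Omega_bot[OF w] Omega_bot[OF w'] by metis
  then have "w $ k $ j \<noteq> 0 \<longleftrightarrow> w' $ k $ j' \<noteq> 0" for k
    using top j'(2) by (cases k) auto
  then show ?thesis using that[of j'] top by blast
qed

text \<open>The columns are matched by their supports, so only signs remain to be found. A column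
  with entries at upper \<open>p\<close> and lower \<open>q\<close> imposes one condition, on
  \<open>e p * e q\<close>; its partner column imposes the same one, so the conditions can be solved
  independently.\<close>

lemma BH_rel_imp_Omega_rel:
  fixes w w' :: "int^'n::{finite,linorder}^('n+'n)"
  assumes rel: "(colspace w, colspace w') \<in> BH_rel cj Sigma_mat"
    and w: "w \<in> Omega_circ" and w': "w' \<in> Omega_circ"
  shows "(w, w') \<in> Omega_rel"
proof -
  have "\<forall>j. \<exists>j'. (\<forall>k. w $ k $ j \<noteq> 0 \<longleftrightarrow> w' $ k $ j' \<noteq> 0) \<and>
    (\<forall>p. w $ Inl p $ j \<noteq> 0 \<longrightarrow> w $ Inr p $ j \<noteq> 0 \<longrightarrow>
      w $ Inl p $ j * w $ Inr p $ j = w' $ Inl p $ j' * w' $ Inr p $ j')"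
    using BH_rel_column_support[OF rel w w'] by metis
  then obtain \<pi> where supp: "\<And>j k. w $ k $ j \<noteq> 0 \<longleftrightarrow> w' $ k $ \<pi> j \<noteq> 0"
    and fixed: "\<And>j p. w $ Inl p $ j \<noteq> 0 \<Longrightarrow> w $ Inr p $ j \<noteq> 0 \<Longrightarrow>
      w $ Inl p $ j * w $ Inr p $ j = w' $ Inl p $ \<pi> j * w' $ Inr p $ \<pi> j"
    by metis
  have "inj \<pi>"
  proof (rule injI)
    fix j j' assume eq: "\<pi> j = \<pi> j'"
    obtain k where "w $ k $ j \<noteq> 0" using Omega_col[OF w] by blast
    moreover from this have "w $ k $ j' \<noteq> 0" using supp eq by metis
    ultimately show "j = j'" by (rule Omega_row[OF w])
  qed
  then have bij: "bij \<pi>" by (simp add: bij_def finite_UNIV_inj_surj)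
  \<comment> \<open>The change of sign at position \<open>(k, j)\<close>; for signs, the product is
    also the quotient.\<close>
  define r where "r k j = w $ k $ j * w' $ k $ \<pi> j" for k j
  have sgn: "w $ k $ j \<in> {-1, 1}" "w' $ k $ \<pi> j \<in> {-1, 1}" "r k j \<in> {-1, 1}" if "w $ k $ j \<noteq> 0" for k j
    using Omega_entry[OF w, of k j] Omega_entry[OF w', of k "\<pi> j"] that supp[of k j] by (auto simp: r_def)
  \<comment> \<open>On a pair of columns at positions \<open>(p, q)\<close> and \<open>(q, p)\<close>, \<open>p < q\<close>, the sign change is put on \<open>e p\<close> alone.\<close>
  define e where "e i = (if \<exists>j q. w $ Inl i $ j \<noteq> 0 \<and> w $ Inr q $ j \<noteq> 0 \<and> i < q \<and> r (Inl i) j * r (Inr q) j = -1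
    then -1 else 1 :: int)" for i
  have e_sgn: "e i \<in> {-1, 1}" for i by (simp add: e_def)
  have e_less: "e p = r (Inl p) j * r (Inr q) j" if "w $ Inl p $ j \<noteq> 0" "w $ Inr q $ j \<noteq> 0" "p < q" for p q j
  proof -
    have "(\<exists>j q. w $ Inl p $ j \<noteq> 0 \<and> w $ Inr q $ j \<noteq> 0 \<and> p < q \<and> r (Inl p) j * r (Inr q) j = -1)
        \<longleftrightarrow> r (Inl p) j * r (Inr q) j = -1"
      using that Omega_row[OF w that(1)] Omega_bot[OF w that(2)] by metis
    then show ?thesis using sgn(3)[OF that(1)] sgn(3)[OF that(2)] by (auto simp: e_def)
  qed
  have e_greater: "e p = 1" if "w $ Inl p $ j \<noteq> 0" "w $ Inr q $ j \<noteq> 0" "q < p" for p q j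
    using that Omega_row[OF w that(1)] Omega_bot[OF w that(2)] unfolding e_def by (metis less_asym)
  have e_mult: "e p * e q = r (Inl p) j * r (Inr q) j"
    if p: "w $ Inl p $ j \<noteq> 0" and q: "w $ Inr q $ j \<noteq> 0" for p q j
  proof -
    obtain j' where j': "w $ Inl q $ j' \<noteq> 0" "w $ Inr p $ j' \<noteq> 0"
      and sym: "w $ Inl p $ j * w $ Inr p $ j' = w $ Inl q $ j' * w $ Inr q $ j"
      using Omega_partner[OF w p q] by metis
    have sym': "w' $ Inl p $ \<pi> j * w' $ Inr p $ \<pi> j' = w' $ Inl q $ \<pi> j' * w' $ Inr q $ \<pi> j"
      using Omega_sym_single[OF w', of p "\<pi> j" q "\<pi> j'"] p q supp by metis
    \<comment> \<open>Multiplying the symmetry relations of \<open>w\<close> and \<open>w'\<close>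
      shows that a column and its partner undergo the same relative change of sign.\<close>
    have partner: "r (Inl p) j * r (Inr q) j = r (Inl q) j' * r (Inr p) j'"
    proof -
      have "r (Inl p) j * r (Inr p) j' = r (Inl q) j' * r (Inr q) j"
        using arg_cong2[OF sym sym', of "(*)"] by (simp add: r_def mult_ac)
      then show ?thesis
        using sgn(3)[OF p] sgn(3)[OF q] sgn(3)[OF j'(1)] sgn(3)[OF j'(2)] by auto
    qed
    consider "p < q" | "p = q" | "q < p" by (rule linorder_cases)
    then show ?thesis
    proof cases
      case 1
      then show ?thesis using e_less[OF p q 1] e_greater[OF j' 1] by simp
    next
      case 2
      have "r (Inl p) j * r (Inr p) j = 1"
        using arg_cong2[OF fixed[of p j] refl, of "(*)" "w' $ Inl p $ \<pi> j * w' $ Inr p $ \<pi> j"] p q sgn(2)[OF p] sgn(2)[OF q]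
        unfolding r_def 2 by auto
      then show ?thesis using e_sgn[of p] 2 by auto
    next
      case 3
      then show ?thesis using e_less[OF j' 3] e_greater[OF p q 3] partner by simp
    qed
  qed
  have "\<exists>\<delta>\<in>{-1, 1}. \<forall>k. w' $ k $ \<pi> j = e (blk_idx k) * w $ k $ j * \<delta>" for j
  proof -
    obtain k where k: "w $ k $ j \<noteq> 0" using Omega_col[OF w] by blast
    \<comment> \<open>The column sign is read off one nonzero entry; \<open>e_mult\<close> makes it
      independent of which entry is used.\<close>
    define \<delta> where "\<delta> = e (blk_idx k) * r k j"
    have \<delta>: "\<delta> \<in> {-1, 1}" using e_sgn[of "blk_idx k"] sgn(3)[OF k] by (auto simp: \<delta>_def)
    have \<delta>_eq: "e (blk_idx l) * r l j = \<delta>" if l: "w $ l $ j \<noteq> 0" for l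
    proof -
      have *: "e p * r (Inl p) j = e q * r (Inr q) j" if "w $ Inl p $ j \<noteq> 0" "w $ Inr q $ j \<noteq> 0" for p q
        using e_mult[OF that] e_sgn[of p] e_sgn[of q] sgn(3)[OF that(1)] sgn(3)[OF that(2)] by auto
      show ?thesis
      proof (cases k; cases l)
        fix p q assume "k = Inl p" "l = Inl q"
        then show ?thesis using Omega_top[OF w] k l by (metis \<delta>_def)
      next
        fix p q assume "k = Inr p" "l = Inr q"
        then show ?thesis using Omega_bot[OF w] k l by (metis \<delta>_def)
      qed (use k l * in \<open>auto simp: \<delta>_def blk_idx_def\<close>)
    qed
    have "w' $ l $ \<pi> j = e (blk_idx l) * w $ l $ j * \<delta>" if "w $ l $ j \<noteq> 0" for l
      using \<delta>_eq[OF that, symmetric] sgn(1,2)[OF that] e_sgn[of "blk_idx l"] by (auto simp: r_def)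
    moreover have "w' $ l $ \<pi> j = e (blk_idx l) * w $ l $ j * \<delta>" if "w $ l $ j = 0" for l
      using that supp[of l j] by simp
    ultimately show ?thesis using \<delta> by blast
  qed
  then obtain \<delta> where "\<And>j. \<delta> j \<in> {-1, 1}" "\<And>j k. w' $ k $ \<pi> j = e (blk_idx k) * w $ k $ j * \<delta> j"
    by metis
  then show ?thesis
    using Omega_relI[of w w' e \<delta> \<pi>] w w' e_sgn bij by simp
qed

end

subsection \<open>Surjectivity\<close>

text \<open>Extend a basis of \<open>D\<close> by \<open>v\<close> and take an endomorphism that
  kills the basis and fixes \<open>v\<close>. A coordinate of it at which \<open>v\<close> is
  nonzero, divided by that entry, is the functional.\<close>

lemma separating_functional:
  fixes D :: "('a::field^'k::finite) set"
  assumes D: "vec.subspace D" and v: "v \<notin> D"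
  obtains \<zeta> where "\<And>u. u \<in> D \<Longrightarrow> (\<Sum>k\<in>UNIV. \<zeta> k * u $ k) = 0" "(\<Sum>k\<in>UNIV. \<zeta> k * v $ k) = 1"
proof -
  obtain B where B: "B \<subseteq> D" "vec.independent B" "D \<subseteq> vec.span B"
    using vec.basis_exists[of D] by metis
  have span: "vec.span B = D"
    using B D vec.span_minimal by blast
  then have ind: "vec.independent (insert v B)"
    using B v vec.independent_insertI by metis
  then obtain g where g: "Vector_Spaces.linear (*s) (*s) g" "\<forall>u\<in>insert v B. g u = (if u = v then v else (0::'a^'k))"
    using vec.linear_independent_extend[OF ind, of "\<lambda>u. if u = v then v else (0::'a^'k)"] by metis
  have "v \<notin> B" using v B by auto
  then have gB: "g u = 0" if "u \<in> B" for u using g(2) that by auto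
  have gD: "g u = 0" if "u \<in> D" for u
    using vec.linear_eq_0_on_span[OF g(1) gB] that span by blast
  have "v \<noteq> 0" using v vec.subspace_0[OF D] by auto
  then obtain l where l: "v $ l \<noteq> 0" by (auto simp: vec_eq_iff)
  have gl: "(\<Sum>k\<in>UNIV. (matrix g $ l $ k / v $ l) * u $ k) = g u $ l / v $ l" for u
    by (subst matrix_works[OF g(1), symmetric]) (simp add: matrix_vector_mult_def sum_divide_distrib)
  show ?thesis
    by (rule that[of "\<lambda>k. matrix g $ l $ k / v $ l"], unfold gl) (use gD g(2) l in auto)
qed

lemma axis_nth_if: "axis i c $ j = (if j = i then c else 0)"
  by (simp add: axis_def)

lemma axis_mult_vec: "(A *v axis i c) $ k = A $ k $ i * c" for c :: "'a::field"
  by (simp add: matrix_vector_mult_def axis_def if_distrib cong: if_cong)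

lemma scale_axis: "a *s axis i c = axis i (a * c)" for c :: "'a::field"
  by (auto simp: vec_eq_iff axis_def)

context involutive_field
begin

text \<open>The column \<open>i \<in> S\<close> is \<open>d\<^sub>i e\<^sub>i + t\<^sub>i e'\<^bsub>\<sigma> i\<^esub>\<close>, i.e. \<open>e\<^sub>i\<close>, \<open>e'\<^sub>i\<close>, \<open>e\<^sub>i \<plusminus> e'\<^sub>i\<close> or, for a 2-cycle of
the involution \<open>\<sigma>\<close>, \<open>e\<^sub>i \<plusminus> e'\<^bsub>\<sigma> i\<^esub>\<close>.\<close>
definition normal_on ::
  "'n set \<Rightarrow> ('n \<Rightarrow> int) \<Rightarrow> ('n \<Rightarrow> int) \<Rightarrow> ('n \<Rightarrow> 'n) \<Rightarrow> ('a^('n::finite+'n)) set \<Rightarrow> bool" where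
  "normal_on S d t \<sigma> W \<longleftrightarrow> (\<forall>i\<in>S. d i \<in> {0, 1} \<and> t i \<in> {-1, 0, 1} \<and> \<sigma> i \<in> S \<and> \<sigma> (\<sigma> i) = i \<and>
     t (\<sigma> i) = t i \<and> (d i = 0 \<longrightarrow> \<sigma> i = i \<and> t i = 1) \<and>
     join_vec (axis i (of_int (d i))) (axis (\<sigma> i) (of_int (t i))) \<in> W)"

text \<open>The vectors supplied by \<open>normal_on\<close> are the columns of a representative.
  Its column space lies in \<open>W\<close> and has the same dimension.\<close>

lemma normal_on_UNIV:
  fixes W :: "('a^('n::finite+'n)) set"
  assumes W: "W \<in> Lag" and n: "normal_on UNIV d t \<sigma> W"
  shows "\<exists>w\<in>Omega_circ. colspace w = W"
proof -
  have d: "d i \<in> {0, 1}" and t: "t i \<in> {-1, 0, 1}" and \<sigma>: "\<sigma> (\<sigma> i) = i" and t\<sigma>: "t (\<sigma> i) = t i"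
    and d0: "d i = 0 \<Longrightarrow> \<sigma> i = i" "d i = 0 \<Longrightarrow> t i = 1"
    and mem: "join_vec (axis i (of_int (d i))) (axis (\<sigma> i) (of_int (t i))) \<in> W" for i
    using n unfolding normal_on_def by blast+
  have \<sigma>_eq: "\<sigma> i = j \<longleftrightarrow> i = \<sigma> j" for i j using \<sigma> by metis
  define w :: "int^'n^('n+'n)" where
    "w = (\<chi> k j. case k of Inl i \<Rightarrow> if i = j then d j else 0 | Inr i \<Rightarrow> if i = \<sigma> j then t j else 0)"
  have w_nth: "w $ Inl i $ j = (if i = j then d j else 0)" "w $ Inr i $ j = (if i = \<sigma> j then t j else 0)" for i j
    by (simp_all add: w_def)
  have \<sigma>_inj: "\<sigma> i = \<sigma> j \<Longrightarrow> i = j" for i j using \<sigma> by metis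
  have "w \<in> Omega_circ"
    unfolding Omega_circ_iff
  proof (intro conjI allI impI)
    fix k :: "'n + 'n" and j j' :: 'n
    show "w $ k $ j \<in> {-1, 0, 1}"
      using d[of j] t[of j] by (cases k) (auto simp: w_nth)
    show "j = j'" if "w $ k $ j \<noteq> 0 \<and> w $ k $ j' \<noteq> 0"
      using that \<sigma>_inj by (cases k) (auto simp: w_nth split: if_splits)
  next
    fix i i' j :: 'n
    show "i = i'" if "w $ Inl i $ j \<noteq> 0 \<and> w $ Inl i' $ j \<noteq> 0"
      using that by (auto simp: w_nth split: if_splits)
    show "i = i'" if "w $ Inr i $ j \<noteq> 0 \<and> w $ Inr i' $ j \<noteq> 0"
      using that by (auto simp: w_nth split: if_splits)
  next
    fix j j' :: 'n
    have "(\<Sum>i\<in>UNIV. w $ Inl i $ j * w $ Inr i $ j') = (if j = \<sigma> j' then d j * t j' else 0)" for j j'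
      by (simp add: w_nth if_distrib[of "\<lambda>c. c * _"] cong: if_cong)
    moreover have "d (\<sigma> j') * t j' = d j' * t (\<sigma> j')"
    proof (cases "d j' = 0 \<or> d (\<sigma> j') = 0")
      case True
      then have "\<sigma> j' = j'" using d0(1) \<sigma> by metis
      then show ?thesis by simp
    next
      case False
      then show ?thesis using d[of j'] d[of "\<sigma> j'"] t\<sigma>[of j'] by auto
    qed
    ultimately show "(\<Sum>i\<in>UNIV. w $ Inl i $ j * w $ Inr i $ j') = (\<Sum>i\<in>UNIV. w $ Inl i $ j' * w $ Inr i $ j)"
      using \<sigma>_eq[of j' j] by auto
  next
    fix j
    show "\<exists>k. w $ k $ j \<noteq> 0"
    proof (cases "d j = 0")
      case True
      then show ?thesis using d0[of j] by (intro exI[of _ "Inr j"]) (simp add: w_nth)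
    next
      case False
      then show ?thesis by (intro exI[of _ "Inl j"]) (simp add: w_nth)
    qed
  qed
  moreover have "(colspace w :: ('a^('n+'n)) set) \<subseteq> W"
  proof
    fix v :: "'a^('n+'n)" assume "v \<in> colspace w"
    then obtain c where v: "v = map_matrix of_int w *v c" by (auto simp: colspace_def)
    have "v = (\<Sum>j\<in>UNIV. c $ j *s join_vec (axis j (of_int (d j))) (axis (\<sigma> j) (of_int (t j))))"
    proof (subst vec_eq_iff, rule allI)
      fix k
      have "join_vec (axis j (of_int (d j))) (axis (\<sigma> j) (of_int (t j))) $ k = (of_int (w $ k $ j) :: 'a)" for j
        by (cases k) (auto simp: w_nth axis_def)
      then show "v $ k = (\<Sum>j\<in>UNIV. c $ j *s join_vec (axis j (of_int (d j))) (axis (\<sigma> j) (of_int (t j)))) $ k"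
        by (simp add: v matrix_vector_mult_def map_matrix_def mult.commute)
    qed
    also have "\<dots> \<in> W"
      by (intro vec.subspace_sum[OF Lag_subspace[OF W]] vec.subspace_scale[OF Lag_subspace[OF W]] mem)
    finally show "v \<in> W" .
  qed
  ultimately show ?thesis
    using vec.subspace_dim_equal[of "colspace w" W] colspace_Lag[of w] W by (auto simp: LagGr_def)
qed

text \<open>Isotropy against the split-off vectors determines half of the coordinates in
  \<open>S\<close> by the other half. Hence the \<open>S\<close>-parts of any two elements of
  \<open>W\<close> are orthogonal, and clearing these coordinates preserves orthogonality to
  \<open>W\<close>; maximality concludes.\<close>

lemma normal_on_project:
  fixes W :: "('a^('n::finite+'n)) set"
  assumes W: "W \<in> Lag" and n: "normal_on S d t \<sigma> W" and xy: "join_vec x y \<in> W"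
  shows "join_vec (\<chi> i. if i \<in> S then 0 else x $ i) (\<chi> i. if i \<in> S then 0 else y $ i) \<in> W"
proof (rule Lag_maximal[OF W])
  fix x' y' assume x'y': "join_vec x' y' \<in> W"
  have d: "d i \<in> {0, 1}" and \<sigma>S: "\<sigma> i \<in> S" and \<sigma>: "\<sigma> (\<sigma> i) = i" and t\<sigma>: "t (\<sigma> i) = t i"
    and d0: "d i = 0 \<Longrightarrow> \<sigma> i = i" "d i = 0 \<Longrightarrow> t i = 1"
    and mem: "join_vec (axis i (of_int (d i))) (axis (\<sigma> i) (of_int (t i))) \<in> W" if "i \<in> S" for i
    using n that unfolding normal_on_def by blast+
  have rel: "of_int (d i) * y $ i = of_int (t i) * x $ \<sigma> i" if "i \<in> S" "join_vec x y \<in> W" for i x y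
    using Lag_isotropic[OF W mem[OF that(1)] that(2)] by (simp add: pairing_axis_left)
  have rel0: "x $ i = 0" if "i \<in> S" "join_vec x y \<in> W" "d i = 0" for i x y
    using rel[OF that(1,2)] d0[OF that(1,3)] that(3) by simp
  have rel1: "y $ i = of_int (t i) * x $ \<sigma> i" if "i \<in> S" "join_vec x y \<in> W" "d i \<noteq> 0" for i x y
    using rel[OF that(1,2)] d[OF that(1)] that(3) by simp
  have S: "(\<Sum>i\<in>S. cj (x' $ i) * y $ i) = (\<Sum>i\<in>S. cj (y' $ i) * x $ i)"
  proof -
    have "(\<Sum>i\<in>S. cj (x' $ i) * y $ i) = (\<Sum>i\<in>S. of_int (t i) * cj (x' $ i) * x $ \<sigma> i)"
    proof (rule sum.cong[OF refl])
      fix i assume i: "i \<in> S"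
      show "cj (x' $ i) * y $ i = of_int (t i) * cj (x' $ i) * x $ \<sigma> i"
        using rel0[OF i x'y'] rel1[OF i xy] by (cases "d i = 0") auto
    qed
    also have "\<dots> = (\<Sum>i\<in>S. of_int (t i) * cj (x' $ \<sigma> i) * x $ i)"
      by (rule sum.reindex_bij_witness[of S \<sigma> \<sigma>]) (auto simp: \<sigma> \<sigma>S t\<sigma>)
    also have "\<dots> = (\<Sum>i\<in>S. cj (y' $ i) * x $ i)"
    proof (rule sum.cong[OF refl])
      fix i assume i: "i \<in> S"
      show "of_int (t i) * cj (x' $ \<sigma> i) * x $ i = cj (y' $ i) * x $ i"
        using rel0[OF i xy] rel1[OF i x'y'] by (cases "d i = 0") (auto simp: cj_mult)
    qed
    finally show ?thesis .
  qed
  have split: "pairing cj u v = (\<Sum>i\<in>S. cj (u $ i) * v $ i) + pairing cj u (\<chi> i. if i \<in> S then 0 else v $ i)"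
    for u v :: "'a^'n"
  proof -
    have "pairing cj u (\<chi> i. if i \<in> S then 0 else v $ i) = (\<Sum>i\<in>-S. cj (u $ i) * v $ i)"
      unfolding pairing_def by (rule sum.mono_neutral_cong_right) auto
    moreover have "pairing cj u v = (\<Sum>i\<in>S. cj (u $ i) * v $ i) + (\<Sum>i\<in>-S. cj (u $ i) * v $ i)"
      unfolding pairing_def by (subst sum.union_disjoint[symmetric]) auto
    ultimately show ?thesis by simp
  qed
  show "pairing cj x' (\<chi> i. if i \<in> S then 0 else y $ i) = pairing cj y' (\<chi> i. if i \<in> S then 0 else x $ i)"
    using Lag_isotropic[OF W x'y' xy] split[of x' y] split[of y' x] S by simp
qed

text \<open>A matrix that is the identity in the rows and columns of \<open>S\<close> fixes the
  split-off vectors in both blocks, so the progress made so far is kept.\<close>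

lemma normal_on_transport:
  fixes W :: "('a^('n::{finite,linorder}+'n)) set"
  assumes n: "normal_on S d t \<sigma> W" and b: "b \<in> upper_borel"
    and fix_S: "\<And>i j. i \<in> S \<or> j \<in> S \<Longrightarrow> b $ i $ j = (if i = j then 1 else 0)"
  shows "normal_on S d t \<sigma> ((\<lambda>v. H_elt cj b *v v) ` W)"
proof -
  have "join_vec (axis i p) (axis j q) \<in> (\<lambda>v. H_elt cj b *v v) ` W"
    if "i \<in> S" "j \<in> S" "join_vec (axis i p) (axis j q) \<in> W" for i j p q
  proof -
    have "b *v axis i p = axis i p"
      using that(1) by (simp add: vec_eq_iff axis_mult_vec fix_S axis_nth_if)
    moreover have "conj_transpose cj b *v axis j q = axis j q"
      using that(2) by (simp add: vec_eq_iff axis_mult_vec conj_transpose_def fix_S axis_nth_if)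
    ultimately show ?thesis
      using H_elt_adjoint[OF b, of "axis j q" "axis j q" "axis i p"] that(3) by (metis image_eqI)
  qed
  then show ?thesis using n unfolding normal_on_def by blast
qed

section \<open>Splitting off one or two further indices\<close>

lemma normal_on_insert:
  assumes n: "normal_on S d t \<sigma> W" and m: "m \<notin> S"
    and "d0 \<in> {0, 1}" "t0 \<in> {-1, 0, 1}" "d0 = 0 \<Longrightarrow> t0 = 1"
    and "join_vec (axis m (of_int d0)) (axis m (of_int t0)) \<in> W"
  shows "normal_on (insert m S) (d(m := d0)) (t(m := t0)) (\<sigma>(m := m)) W"
proof -
  have "i \<noteq> m \<and> \<sigma> i \<noteq> m" if "i \<in> S" for i
    using n m that unfolding normal_on_def by metis
  then show ?thesis
    using assms unfolding normal_on_def by auto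
qed

lemma normal_on_insert2:
  assumes n: "normal_on S d t \<sigma> W" and m: "m \<notin> S" "p \<notin> S" "m \<noteq> p"
    and mem: "join_vec (axis m 1) (axis p 1) \<in> W" "join_vec (axis p 1) (axis m 1) \<in> W"
  shows "normal_on (insert m (insert p S)) (d(m := 1, p := 1)) (t(m := 1, p := 1)) (\<sigma>(m := p, p := m)) W"
proof -
  have "i \<noteq> m \<and> \<sigma> i \<noteq> m \<and> i \<noteq> p \<and> \<sigma> i \<noteq> p" if "i \<in> S" for i
    using n m that unfolding normal_on_def by metis
  then show ?thesis
    using assms unfolding normal_on_def by auto
qed

text \<open>Isotropy makes \<open>a\<close> selfadjoint, so \<open>u\<close> can be chosen with
  \<open>a * (u * cj u)\<close> in {0, 1, -1}. The matrix \<open>b\<close> is the identity except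
  for row \<open>m\<close>, which is \<open>u\<close> times \<open>y^*\<close>; its adjoint thus
  maps \<open>e_m\<close> to \<open>cj u *s y\<close>.\<close>

lemma normal_step_single:
  fixes W :: "('a^('n::{finite,linorder}+'n)) set"
  assumes W: "W \<in> Lag" and n: "normal_on S d t \<sigma> W" and m: "m \<notin> S" "\<And>k. k < m \<Longrightarrow> k \<in> S"
    and y: "y $ m = 1" "\<And>i. i \<in> S \<Longrightarrow> y $ i = 0" and mem: "join_vec (axis m a) y \<in> W"
  shows "\<exists>b\<in>upper_borel. \<exists>d' t' \<sigma>'. normal_on (insert m S) d' t' \<sigma>' ((\<lambda>v. H_elt cj b *v v) ` W)"
proof -
  have cja: "cj a = a"
    using Lag_isotropic[OF W mem mem] y(1) by (simp add: pairing_axis_left pairing_axis_right)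
  obtain u where u: "u \<noteq> 0" "a * (u * cj u) \<in> {0, 1, -1}"
  proof (cases "a = 0")
    case True
    then show ?thesis by (intro that[of 1]) auto
  next
    case False
    then obtain u where "u \<noteq> 0" "a * (u * cj u) = 1 \<or> a * (u * cj u) = -1"
      using selfadjoint_scale[OF cja] by blast
    then show ?thesis by (intro that[of u]) auto
  qed
  define b :: "(('a, 'n) vec, 'n) vec" where
    "b = (\<chi> k l. if k = m then u * cj (y $ l) else if k = l then 1 else 0)"
  have b: "b \<in> upper_borel"
    using m y u by (intro upper_borelI) (auto simp: b_def)
  let ?W = "(\<lambda>v. H_elt cj b *v v) ` W"
  have W': "?W \<in> Lag" by (rule BH_image_Lag[OF W b])
  have n': "normal_on S d t \<sigma> ?W"
    using m y by (intro normal_on_transport[OF n b]) (auto simp: b_def)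
  have "b *v (cj u *s axis m a) = axis m (a * (u * cj u))"
    using y(1) by (auto simp: vec_eq_iff scale_axis axis_mult_vec b_def axis_nth_if)
  moreover have "conj_transpose cj b *v axis m 1 = cj u *s y"
    by (auto simp: vec_eq_iff axis_mult_vec conj_transpose_def b_def cj_mult)
  ultimately have new: "join_vec (axis m (a * (u * cj u))) (axis m 1) \<in> ?W"
    using H_elt_adjoint[OF b, of "axis m 1" "cj u *s y" "cj u *s axis m a"] Lag_scale[OF W mem, of "cj u"]
    by (metis image_eqI)
  have "\<exists>d0 t0. d0 \<in> {0, 1} \<and> t0 \<in> {-1, 0, 1} \<and> (d0 = 0 \<longrightarrow> t0 = 1) \<and>
      join_vec (axis m (of_int d0)) (axis m (of_int t0)) \<in> ?W"
  proof -
    consider "a * (u * cj u) = 0" | "a * (u * cj u) = 1" | "a * (u * cj u) = -1" using u(2) by blast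
    then show ?thesis
    proof cases
      case 1
      show ?thesis by (rule exI[of _ 0], rule exI[of _ 1]) (use new[unfolded 1] in simp)
    next
      case 2
      show ?thesis by (rule exI[of _ 1], rule exI[of _ 1]) (use new[unfolded 2] in simp)
    next
      \<comment> \<open>The vector found is \<open>(-e_m, e_m)\<close>; the normal form wants a
        nonnegative upper coefficient, so it is negated.\<close>
      case 3
      show ?thesis
        by (rule exI[of _ 1], rule exI[of _ "-1"])
          (use Lag_scale[OF W' new[unfolded 3], of "-1"] in \<open>simp add: scale_axis\<close>)
    qed
  qed
  then show ?thesis
    using normal_on_insert[OF n' m(1)] b by metis
qed

text \<open>A duality argument. By \<open>van\<close>, the vector \<open>(0, e_m)\<close> is not in
  the projection \<open>D\<close> of the elements of \<open>W\<close> vanishing on \<open>S\<close>,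
  where only the upper coordinates from \<open>p\<close> on and the lower coordinate
  \<open>m\<close> are kept. The coefficients of a functional separating it from \<open>D\<close>
  give \<open>z\<close>, and vanishing on \<open>D\<close> becomes orthogonality of
  \<open>(e_m, z)\<close> to \<open>W\<close>.\<close>

lemma normal_partner_exists:
  fixes W :: "('a^('n::{finite,linorder}+'n)) set"
  assumes W: "W \<in> Lag" and n: "normal_on S d t \<sigma> W" and m: "m \<notin> S"
    and van: "\<And>x y. join_vec x y \<in> W \<Longrightarrow> (\<And>i. i \<in> S \<Longrightarrow> x $ i = 0 \<and> y $ i = 0) \<Longrightarrow>
      (\<And>i. p \<le> i \<Longrightarrow> x $ i = 0) \<Longrightarrow> y $ m = 0"
  obtains z where "join_vec (axis m 1) z \<in> W" "\<And>i. i < p \<or> i \<in> S \<Longrightarrow> z $ i = 0"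
proof -
  define R where "R x y = join_vec (\<chi> i. if p \<le> i then x $ i else 0) (axis m (y $ m))" for x y :: "('a, 'n) vec"
  define D where "D = {R x y | x y. join_vec x y \<in> W \<and> (\<forall>i\<in>S. x $ i = 0 \<and> y $ i = 0)}"
  have sub: "vec.subspace W" by (rule Lag_subspace[OF W])
  have "vec.subspace D"
  proof (rule vec.subspaceI)
    have "0 = join_vec 0 (0 :: ('a, 'n) vec)"
      by (auto simp: vec_eq_iff join_vec_def split: sum.split)
    then have "join_vec 0 (0 :: ('a, 'n) vec) \<in> W" using vec.subspace_0[OF sub] by simp
    moreover have "0 = R 0 0"
      by (auto simp: R_def vec_eq_iff join_vec_def axis_def split: sum.split)
    ultimately show "0 \<in> D" unfolding D_def by force
  next
    fix u v assume "u \<in> D" "v \<in> D"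
    then obtain x y x' y' where *: "u = R x y" "v = R x' y'" "join_vec x y \<in> W" "join_vec x' y' \<in> W"
      "\<forall>i\<in>S. x $ i = 0 \<and> y $ i = 0" "\<forall>i\<in>S. x' $ i = 0 \<and> y' $ i = 0"
      unfolding D_def by blast
    have "u + v = R (x + x') (y + y')"
      by (auto simp: * R_def vec_eq_iff join_vec_def axis_def split: sum.split)
    moreover have "join_vec (x + x') (y + y') \<in> W"
      using vec.subspace_add[OF sub *(3,4)] by (simp add: join_vec_add)
    ultimately show "u + v \<in> D" using *(5,6) unfolding D_def by force
  next
    fix c u assume "u \<in> D"
    then obtain x y where *: "u = R x y" "join_vec x y \<in> W" "\<forall>i\<in>S. x $ i = 0 \<and> y $ i = 0"
      unfolding D_def by blast
    have "c *s u = R (c *s x) (c *s y)"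
      by (auto simp: * R_def vec_eq_iff join_vec_def axis_def split: sum.split)
    then show "c *s u \<in> D" using Lag_scale[OF W *(2), of c] *(3) unfolding D_def by force
  qed
  moreover have "join_vec 0 (axis m 1) \<notin> D"
  proof
    assume "join_vec 0 (axis m 1) \<in> D"
    then obtain x y where *: "join_vec 0 (axis m 1) = R x y" "join_vec x y \<in> W" "\<forall>i\<in>S. x $ i = 0 \<and> y $ i = 0"
      unfolding D_def by blast
    have "y $ m = 1" using arg_cong[OF *(1), of "\<lambda>v. v $ Inr m"] by (simp add: R_def)
    moreover have "x $ i = 0" if "p \<le> i" for i
      using arg_cong[OF *(1), of "\<lambda>v. v $ Inl i"] that by (simp add: R_def)
    ultimately show False using van[OF *(2)] *(3) by auto
  qed
  ultimately obtain \<zeta> where \<zeta>: "\<And>u. u \<in> D \<Longrightarrow> (\<Sum>k\<in>UNIV. \<zeta> k * u $ k) = 0"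
    "(\<Sum>k\<in>UNIV. \<zeta> k * join_vec 0 (axis m 1) $ k) = 1"
    by (rule separating_functional) blast
  have \<zeta>m: "\<zeta> (Inr m) = 1"
    using \<zeta>(2) by (simp add: sum_UNIV_Plus axis_def if_distrib cong: if_cong)
  define z :: "('a, 'n) vec" where "z = (\<chi> i. if p \<le> i \<and> i \<notin> S then - cj (\<zeta> (Inl i)) else 0)"
  have "join_vec (axis m 1) z \<in> W"
  proof (rule Lag_maximal[OF W])
    fix x y assume xy: "join_vec x y \<in> W"
    let ?x = "\<chi> i. if i \<in> S then 0 else x $ i" and ?y = "\<chi> i. if i \<in> S then 0 else y $ i"
    \<comment> \<open>Clearing the coordinates in \<open>S\<close> is harmless: \<open>z\<close>
      vanishes there and \<open>m\<close> is not in \<open>S\<close>.\<close>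
    have "R ?x ?y \<in> D"
      using normal_on_project[OF W n xy] unfolding D_def by force
    then have "(\<Sum>k\<in>UNIV. \<zeta> k * R ?x ?y $ k) = 0" by (rule \<zeta>(1))
    moreover have "(\<Sum>k\<in>UNIV. \<zeta> k * R ?x ?y $ k) = (\<Sum>i\<in>UNIV. \<zeta> (Inl i) * (if p \<le> i then ?x $ i else 0)) + y $ m"
      using m by (simp add: sum_UNIV_Plus R_def \<zeta>m axis_def if_distrib cong: if_cong)
    moreover have "cj (pairing cj x z) = - (\<Sum>i\<in>UNIV. \<zeta> (Inl i) * (if p \<le> i then ?x $ i else 0))"
      unfolding pairing_def cj_sum sum_negf[symmetric] by (intro sum.cong) (auto simp: z_def cj_mult)
    ultimately have "cj (pairing cj x z) = y $ m" by (metis minus_unique)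
    then have "pairing cj x z = cj (y $ m)" by (metis cj_cj)
    then show "pairing cj x z = pairing cj y (axis m 1)" by (simp add: pairing_axis_right)
  qed
  moreover have "z $ i = 0" if "i < p \<or> i \<in> S" for i
    using that by (auto simp: z_def)
  ultimately show ?thesis by (rule that)
qed

text \<open>Rows \<open>m\<close> and \<open>p\<close> of \<open>b\<close> are \<open>y'^*\<close>
  and \<open>z^*\<close>, so the adjoint maps \<open>e_m\<close> to \<open>y'\<close> and
  \<open>e_p\<close> to \<open>z\<close>. The other rows eliminate the entries of \<open>x'\<close>
  with pivot \<open>p\<close>; this is upper triangular because \<open>x'\<close> ends at
  \<open>p\<close>. Thus \<open>(x', y')\<close> becomes \<open>(e_p, e_m)\<close> and
  \<open>(e_m, z)\<close> becomes \<open>(e_m, e_p)\<close>.\<close>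

lemma normal_step_pair:
  fixes W :: "('a^('n::{finite,linorder}+'n)) set"
  assumes W: "W \<in> Lag" and n: "normal_on S d t \<sigma> W" and m: "m \<notin> S" "\<And>k. k < m \<Longrightarrow> k \<in> S"
    and p: "p \<notin> S" "m < p"
    and y: "y $ m = 1" "\<And>i. i \<in> S \<Longrightarrow> x $ i = 0 \<and> y $ i = 0" and mem: "join_vec x y \<in> W"
    and x: "x $ p \<noteq> 0" "\<And>k. p < k \<Longrightarrow> x $ k = 0"
    and z: "join_vec (axis m 1) z \<in> W" "\<And>i. i < p \<or> i \<in> S \<Longrightarrow> z $ i = 0"
  shows "\<exists>b\<in>upper_borel. \<exists>d' t' \<sigma>'. normal_on (insert m (insert p S)) d' t' \<sigma>' ((\<lambda>v. H_elt cj b *v v) ` W)"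
proof -
  define h where "h = pairing cj y x"
  \<comment> \<open>\<open>b x' = e\<^sub>p\<close> and row \<open>m\<close> of \<open>b\<close> being \<open>y'\<^sup>*\<close> forces \<open>y'\<^sup>* x' = 0\<close>, hence the correction by \<open>h/2\<close>.\<close>
  define x' where "x' = x - (h/2) *s axis m 1"
  define y' where "y' = y - (h/2) *s z"
  have mem': "join_vec x' y' \<in> W"
    using Lag_diff[OF W mem Lag_scale[OF W z(1), of "h/2"]] by (simp add: x'_def y'_def)
  have hh: "cj h = h" using Lag_isotropic[OF W mem mem] by (simp add: h_def cj_pairing)
  have zm: "z $ m = 0" using z(2) p by blast
  have zx: "pairing cj z x = 1"
    using Lag_isotropic[OF W mem z(1)] y(1) cj_pairing[of x z] by (simp add: pairing_axis_right)
  have y'm: "y' $ m = 1" using y zm by (simp add: y'_def)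
  have S': "x' $ i = 0" "y' $ i = 0" if "i \<in> S" for i
    using y(2)[OF that] z(2)[of i] that m(1) by (auto simp: x'_def y'_def axis_def)
  have x'_last: "x' $ k = 0" if "p < k" for k
    using x p that by (auto simp: x'_def axis_def)
  have x'p0: "x' $ p \<noteq> 0" using x p by (auto simp: x'_def axis_def)
  have yx': "pairing cj y' x' = 0"
    by (simp add: x'_def y'_def pairing_diff_left pairing_diff_right pairing_scale_left pairing_scale_right
        pairing_axis_right zm zx y(1) cj_half hh h_def[symmetric] field_simps)
  have zx': "pairing cj z x' = 1"
    by (simp add: x'_def pairing_diff_right pairing_scale_right pairing_axis_right zm zx)
  \<comment> \<open>As \<open>z\<close> starts at \<open>p\<close> or later and \<open>x\<close>
    ends at \<open>p\<close>, the pairing of \<open>z\<close> and \<open>x\<close>, which is 1,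
    consists of the term at \<open>p\<close> alone.\<close>
  have zp: "z $ p \<noteq> 0"
  proof
    assume "z $ p = 0"
    then have "cj (z $ i) * x $ i = 0" for i
      using z(2)[of i] x(2)[of i] by (cases i p rule: linorder_cases) auto
    then have "pairing cj z x = 0" unfolding pairing_def by (intro sum.neutral ballI)
    then show False using zx by simp
  qed
  define b :: "(('a, 'n) vec, 'n) vec" where
    "b = (\<chi> k l. if k = m then cj (y' $ l) else if k = p then cj (z $ l)
      else (if k = l then 1 else 0) - (if l = p then x' $ k / x' $ p else 0))"
  have b: "b \<in> upper_borel"
  proof (rule upper_borelI)
    show "b $ i $ j = 0" if "j < i" for i j
      using that m(2)[of j] S'(2)[of j] z(2)[of j] x'_last[of i] by (auto simp: b_def)
    show "b $ i $ i \<noteq> 0" for i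
      using y'm zp by (auto simp: b_def)
  qed
  let ?W = "(\<lambda>v. H_elt cj b *v v) ` W"
  have n': "normal_on S d t \<sigma> ?W"
  proof (rule normal_on_transport[OF n b])
    fix i j assume "i \<in> S \<or> j \<in> S"
    then show "b $ i $ j = (if i = j then 1 else 0)"
      using m(1) p(1) S'[of i] S'[of j] z(2)[of j] by (auto simp: b_def)
  qed
  have bx: "b *v x' = axis p 1"
  proof (subst vec_eq_iff, rule allI)
    fix k
    consider "k = m" | "k = p" | "k \<noteq> m" "k \<noteq> p" by blast
    then show "(b *v x') $ k = axis p 1 $ k"
    proof cases
      case 1
      then have "(b *v x') $ k = pairing cj y' x'"
        by (simp add: matrix_vector_mult_def b_def pairing_def)
      then show ?thesis using yx' p 1 by (simp add: axis_def)
    next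
      case 2
      then have "(b *v x') $ k = pairing cj z x'"
        using less_imp_neq[OF p(2), symmetric] by (simp add: matrix_vector_mult_def b_def pairing_def)
      then show ?thesis using zx' 2 by (simp add: axis_def)
    next
      case 3
      then have "(b *v x') $ k = (\<Sum>l\<in>UNIV. (if k = l then x' $ l else 0) - (if l = p then x' $ k / x' $ p * x' $ l else 0))"
        by (auto simp: matrix_vector_mult_def b_def left_diff_distrib intro!: sum.cong)
      also have "\<dots> = 0" using x'p0 by (simp add: sum_subtractf)
      finally show ?thesis using 3 by (simp add: axis_def)
    qed
  qed
  have bm: "b *v axis m 1 = axis m 1"
    using p zm y'm by (auto simp: vec_eq_iff axis_mult_vec b_def axis_nth_if)
  have cm: "conj_transpose cj b *v axis m 1 = y'" "conj_transpose cj b *v axis p 1 = z"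
    using p by (auto simp: vec_eq_iff axis_mult_vec conj_transpose_def b_def)
  have "join_vec (axis p 1) (axis m 1) \<in> ?W"
    using H_elt_adjoint[OF b cm(1), of x'] bx mem' by (metis image_eqI)
  moreover have "join_vec (axis m 1) (axis p 1) \<in> ?W"
    using H_elt_adjoint[OF b cm(2), of "axis m 1"] bm z(1) by (metis image_eqI)
  ultimately show ?thesis
    using normal_on_insert2[OF n' m(1) p(1)] p(2) b by blast
qed

lemma normal_step:
  fixes W :: "('a^('n::{finite,linorder}+'n)) set"
  assumes W: "W \<in> Lag" and n: "normal_on S d t \<sigma> W" and S: "S \<noteq> UNIV"
  shows "\<exists>b\<in>upper_borel. \<exists>S' d' t' \<sigma>'. S \<subset> S' \<and> normal_on S' d' t' \<sigma>' ((\<lambda>v. H_elt cj b *v v) ` W)"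
proof -
  define m where "m = Min (-S)"
  have m: "m \<notin> S"
    using Min_in[of "-S"] S by (auto simp: m_def)
  have psub: "S \<subset> insert m S" using m by blast
  have less_m: "k \<in> S" if "k < m" for k
    using that Min_le[of "-S" k] by (auto simp: m_def not_le[symmetric])
  define T where "T x y \<longleftrightarrow> join_vec x y \<in> W \<and> (\<forall>i\<in>S. x $ i = 0 \<and> y $ i = 0)" for x y
  have normalize: "T ((1 / y $ m) *s x) ((1 / y $ m) *s y)" if "T x y" for x y
    using that Lag_scale[OF W] by (auto simp: T_def)
  have single: ?thesis
    if "\<exists>b\<in>upper_borel. \<exists>d' t' \<sigma>'. normal_on (insert m S) d' t' \<sigma>' ((\<lambda>v. H_elt cj b *v v) ` W)"
    using that psub by blast
  show ?thesis
  proof (cases "join_vec (axis m 1) 0 \<in> W")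
    case True
    have eq: "(\<lambda>v. H_elt cj (mat 1) *v v) ` W = W"
      by (simp add: H_elt_1)
    have "normal_on (insert m S) (d(m := 1)) (t(m := 0)) (\<sigma>(m := m)) W"
      using normal_on_insert[OF n m, of 1 0] True by (simp add: axis_def zero_vec_def cong: if_cong)
    then have "\<exists>S' d' t' \<sigma>'. S \<subset> S' \<and> normal_on S' d' t' \<sigma>' ((\<lambda>v. H_elt cj (mat 1) *v v) ` W)"
      unfolding eq using psub by blast
    then show ?thesis
      using mat_1_upper_borel by (rule bexI)
  next
    case False
    \<comment> \<open>By maximality some element of \<open>W\<close> is not orthogonal to
      \<open>(e_m, 0)\<close>, which means that its lower coordinate \<open>m\<close> is
      nonzero.\<close>
    then obtain x0 y0 where 0: "join_vec x0 y0 \<in> W" "pairing cj x0 0 \<noteq> pairing cj y0 (axis m 1)"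
      using Lag_maximal[OF W] by metis
    then have "y0 $ m \<noteq> 0" by (auto simp: pairing_axis_right)
    moreover define x1 where "x1 = (\<chi> i. if i \<in> S then 0 else x0 $ i)"
    moreover define y1 where "y1 = (\<chi> i. if i \<in> S then 0 else y0 $ i)"
    ultimately have "T x1 y1" "y1 $ m \<noteq> 0"
      using normal_on_project[OF W n 0(1)] m by (auto simp: T_def)
    then obtain x2 y2 where 2: "T x2 y2" "y2 $ m = 1"
      using normalize by fastforce
    show ?thesis
    proof (cases "\<exists>y. T 0 y \<and> y $ m = 1")
      case True
      then obtain y where y: "join_vec 0 y \<in> W" "y $ m = 1" "\<And>i. i \<in> S \<Longrightarrow> y $ i = 0"
        by (auto simp: T_def)
      have mem: "join_vec (axis m 0) y \<in> W" using y by (simp add: axis_def zero_vec_def cong: if_cong)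
      show ?thesis
        by (rule single[OF normal_step_single[OF W n m less_m y(2,3) mem]])
    next
      case no_T0: False
      define P where "P q \<longleftrightarrow> (\<exists>x y. T x y \<and> y $ m = 1 \<and> x $ q \<noteq> 0 \<and> (\<forall>k>q. x $ k = 0))" for q
      have "x2 \<noteq> 0" using no_T0 2 by auto
      then have "\<exists>q. P q"
        using 2 obtain_last_nonzero unfolding P_def by metis
      define p where "p = Min (Collect P)"
      have "P p" using Min_in[of "Collect P"] \<open>\<exists>q. P q\<close> by (auto simp: p_def)
      then obtain x y where xy: "join_vec x y \<in> W" "\<And>i. i \<in> S \<Longrightarrow> x $ i = 0 \<and> y $ i = 0"
        "y $ m = 1" "x $ p \<noteq> 0" "\<And>k. p < k \<Longrightarrow> x $ k = 0"
        unfolding P_def T_def by blast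
      have pS: "p \<notin> S" using xy(2,4) by blast
      have p_min: "p \<le> q" if "P q" for q
        using that by (simp add: p_def)
      show ?thesis
      proof (cases "p = m")
        case True
        \<comment> \<open>All indices below \<open>m\<close> lie in \<open>S\<close>, where
          \<open>x\<close> vanishes, and \<open>x\<close> ends at \<open>m\<close>.\<close>
        have "x = axis m (x $ m)"
        proof (subst vec_eq_iff, rule allI)
          fix k show "x $ k = axis m (x $ m) $ k"
            using xy(2)[OF less_m, of k] xy(5)[of k] True by (cases k m rule: linorder_cases) (auto simp: axis_def)
        qed
        then have mem: "join_vec (axis m (x $ m)) y \<in> W" using xy(1) by simp
        show ?thesis
          by (rule single[OF normal_step_single[OF W n m less_m xy(3) _ mem]]) (use xy(2) in blast)+
      next
        case False
        then have mp: "m < p" using less_m[of p] pS by fastforce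
        \<comment> \<open>Otherwise, after scaling, the last nonzero position of \<open>u\<close>
          would satisfy \<open>P\<close> and lie before \<open>p\<close>.\<close>
        have "v $ m = 0" if uv: "join_vec u v \<in> W" "\<And>i. i \<in> S \<Longrightarrow> u $ i = 0 \<and> v $ i = 0"
          and u: "\<And>i. p \<le> i \<Longrightarrow> u $ i = 0" for u v
        proof (rule ccontr)
          assume nz: "v $ m \<noteq> 0"
          let ?u = "(1 / v $ m) *s u" and ?v = "(1 / v $ m) *s v"
          have uv': "T ?u ?v" "?v $ m = 1" using normalize[of u v] uv nz by (auto simp: T_def)
          then have "?u \<noteq> 0" using no_T0 by metis
          then obtain q where q: "?u $ q \<noteq> 0" "\<And>k. q < k \<Longrightarrow> ?u $ k = 0"
            using obtain_last_nonzero by blast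
          then have "P q" unfolding P_def using uv' by blast
          then have "p \<le> q" by (rule p_min)
          then show False using u[of q] q(1) by simp
        qed
        then obtain z where z: "join_vec (axis m 1) z \<in> W" "\<And>i. i < p \<or> i \<in> S \<Longrightarrow> z $ i = 0"
          using normal_partner_exists[OF W n m, of p] by metis
        have "S \<subset> insert m (insert p S)" using m by blast
        then show ?thesis
          using normal_step_pair[OF W n m less_m pS mp xy(3,2,1,4,5) z] by metis
      qed
    qed
  qed
qed

text \<open>Induction on the number of indices not yet split off, started at \<open>S = {}\<close>,
  where \<open>normal_on\<close> holds vacuously. Each step replaces \<open>W\<close> by another
  point of its orbit.\<close>

lemma Omega_circ_represents:
  fixes W :: "('a^('n::{finite,linorder}+'n)) set"
  assumes "W \<in> Lag"
  shows "\<exists>w\<in>Omega_circ. (colspace w, W) \<in> BH_rel cj Sigma_mat"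
proof -
  have "\<exists>w\<in>Omega_circ. (colspace w, W) \<in> BH_rel cj Sigma_mat"
    if "W \<in> Lag" "normal_on S d t \<sigma> W" for S d t \<sigma> and W :: "('a, 'n + 'n) vec set"
    using that
  proof (induction "card (-S)" arbitrary: S d t \<sigma> W rule: less_induct)
    case less
    show ?case
    proof (cases "S = UNIV")
      case True
      then show ?thesis
        using normal_on_UNIV[of W] less.prems equiv_class_self equiv_BH_rel
        by (metis equiv_def refl_on_def)
    next
      case False
      obtain b S' d' t' \<sigma>' where b: "b \<in> upper_borel" "S \<subset> S'"
        "normal_on S' d' t' \<sigma>' ((\<lambda>v. H_elt cj b *v v) ` W)"
        using normal_step[OF less.prems False] by blast
      have W': "(\<lambda>v. H_elt cj b *v v) ` W \<in> Lag" by (rule BH_image_Lag[OF less.prems(1) b(1)])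
      have "card (-S') < card (-S)" using b(2) by (intro psubset_card_mono) auto
      then obtain w where "w \<in> Omega_circ" "(colspace w, (\<lambda>v. H_elt cj b *v v) ` W) \<in> BH_rel cj Sigma_mat"
        using less.hyps[OF _ W' b(3)] by blast
      moreover have "(W, (\<lambda>v. H_elt cj b *v v) ` W) \<in> BH_rel cj Sigma_mat"
        using b less.prems(1) W' unfolding BH_rel_def by blast
      ultimately show ?thesis
        using equiv_BH_rel by (meson equiv_def symD transD)
    qed
  qed
  moreover have "normal_on {} d t \<sigma> W" for d t \<sigma> by (simp add: normal_on_def)
  ultimately show ?thesis using assms by blast
qed

end

subsection \<open>The orbit bijection\<close>

text \<open>By \<open>rs\<close> the union over a class of \<open>r\<close> is the single class of
  \<open>f a\<close> for any representative \<open>a\<close>; the two directions of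
  \<open>rs\<close> give well-definedness and injectivity.\<close>

lemma bij_betw_quotients:
  assumes r: "equiv A r" and s: "equiv B s" and f: "f ` A \<subseteq> B"
    and rs: "\<And>x y. x \<in> A \<Longrightarrow> y \<in> A \<Longrightarrow> (x, y) \<in> r \<longleftrightarrow> (f x, f y) \<in> s"
    and surj: "\<And>y. y \<in> B \<Longrightarrow> \<exists>x\<in>A. (f x, y) \<in> s"
  shows "bij_betw (\<lambda>X. \<Union>x\<in>X. s `` {f x}) (A // r) (B // s)"
proof -
  have val: "(\<Union>x\<in>r `` {a}. s `` {f x}) = s `` {f a}" if a: "a \<in> A" for a
  proof -
    have "s `` {f x} = s `` {f a}" if "x \<in> r `` {a}" for x
    proof -
      have "x \<in> A" "(a, x) \<in> r" using that r by (auto simp: equiv_def)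
      then show ?thesis using rs[OF a] s by (metis equiv_class_eq)
    qed
    moreover have "a \<in> r `` {a}" using r a by (rule equiv_class_self)
    ultimately show ?thesis by blast
  qed
  show ?thesis
  proof (rule bij_betw_imageI)
    show "inj_on (\<lambda>X. \<Union>x\<in>X. s `` {f x}) (A // r)"
    proof (rule inj_onI)
      fix X Y assume "X \<in> A // r" "Y \<in> A // r" and eq: "(\<Union>x\<in>X. s `` {f x}) = (\<Union>x\<in>Y. s `` {f x})"
      then obtain a b where ab: "a \<in> A" "b \<in> A" "X = r `` {a}" "Y = r `` {b}" by (auto elim!: quotientE)
      then have "s `` {f a} = s `` {f b}" using eq val by simp
      then have "(f a, f b) \<in> s" using ab f eq_equiv_class_iff[OF s, of "f a" "f b"] by blast
      then show "X = Y" using ab rs r by (metis equiv_class_eq)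
    qed
    show "(\<lambda>X. \<Union>x\<in>X. s `` {f x}) ` (A // r) = B // s"
    proof
      show "(\<lambda>X. \<Union>x\<in>X. s `` {f x}) ` (A // r) \<subseteq> B // s"
        using f val by (auto elim!: quotientE intro!: quotientI)
      show "B // s \<subseteq> (\<lambda>X. \<Union>x\<in>X. s `` {f x}) ` (A // r)"
      proof
        fix Y assume "Y \<in> B // s"
        then obtain y where y: "y \<in> B" "Y = s `` {y}" by (auto elim!: quotientE)
        obtain x where x: "x \<in> A" "(f x, y) \<in> s" using surj[OF y(1)] by blast
        then have "Y = s `` {f x}" using y s by (metis equiv_class_eq)
        then show "Y \<in> (\<lambda>X. \<Union>x\<in>X. s `` {f x}) ` (A // r)"
          using val[OF x(1)] x(1) by (auto intro!: image_eqI[of _ _ "r `` {x}"] quotientI)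
      qed
    qed
  qed
qed

context involutive_field
begin

lemma orbit_bijection_Sigma:
  "orbit_bijection cj (Sigma_mat :: (('a, 'n::{finite,linorder} + 'n) vec, 'n + 'n) vec)"
  unfolding orbit_bijection_def induced_map_def[abs_def]
proof (rule bij_betw_quotients[OF equiv_Omega_rel equiv_BH_rel])
  show "colspace ` Omega_circ \<subseteq> (Lag :: ('a, 'n + 'n) vec set set)"
    using colspace_Lag by blast
  show "(w, w') \<in> Omega_rel \<longleftrightarrow> (colspace w, colspace w') \<in> BH_rel cj (Sigma_mat :: (('a, 'n + 'n) vec, 'n + 'n) vec)"
    if "w \<in> Omega_circ" "w' \<in> Omega_circ" for w w'
    using that Omega_rel_imp_BH_rel BH_rel_imp_Omega_rel by blast
qed (rule Omega_circ_represents)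

end

section \<open>The complex and the real case\<close>

interpretation complex_cnj: involutive_field cnj
proof
  fix u x :: complex
  show "u * cnj u \<noteq> -1"
  proof
    assume "u * cnj u = -1"
    then have "Re (u * cnj u) = -1" by simp
    moreover have "Re (u * cnj u) \<ge> 0" by simp
    ultimately show False by linarith
  qed
  assume x: "cnj x = x" "x \<noteq> 0"
  then obtain a where a: "x = of_real a" by (metis Reals_cases Reals_cnj_iff)
  \<comment> \<open>A selfadjoint number is real, and scaling by the square of this \<open>r\<close>
    leaves just its sign.\<close>
  define r where "r = 1 / sqrt \<bar>a\<bar>"
  have "r \<noteq> 0" "a * (r * r) = sgn a" using x a by (auto simp: r_def sgn_if field_simps)
  then show "\<exists>u. u \<noteq> 0 \<and> (x * (u * cnj u) = 1 \<or> x * (u * cnj u) = -1)"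
    using x a by (intro exI[of _ "of_real r"]) (auto simp: sgn_if simp flip: of_real_mult split: if_splits)
qed auto

interpretation real_id: involutive_field "\<lambda>x::real. x"
proof
  fix u x :: real
  show "u * u \<noteq> -1" using zero_le_square[of u] by linarith
  assume x: "x \<noteq> 0"
  define r where "r = 1 / sqrt \<bar>x\<bar>"
  have "r \<noteq> 0" "x * (r * r) = sgn x" using x by (auto simp: r_def sgn_if field_simps)
  then show "\<exists>u. u \<noteq> 0 \<and> (x * (u * u) = 1 \<or> x * (u * u) = -1)"
    using x by (intro exI[of _ r]) (auto simp: sgn_if split: if_splits)
qed auto

theorem theorem5p5:
  fixes n_type :: "'n::{finite,linorder} itself"
  shows "orbit_bijection cnj (J_mat :: ((complex, 'n + 'n) vec, 'n + 'n) vec)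
       \<and> orbit_bijection (\<lambda>x::real. x) (Sigma_mat :: ((real, 'n + 'n) vec, 'n + 'n) vec)"
  using complex_cnj.orbit_bijection_Sigma real_id.orbit_bijection_Sigma
  by (simp add: orbit_bijection_J)

end
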